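(* A quotient group of a group from the class $\mathcal{MZ}$ need not belong to the class $\mathcal{MZ}$; that is, there exist a group $G\in\mathcal{MZ}$ and a normal subgroup $N$ of $G$ such that $G/N\notin\mathcal{MZ}$.
   Context: Let $G$ be a group with identity $1$. Pick $x\notin G$ and let $G*\langle x\rangle$ be the free product of $G$ with the infinite cyclic group $\langle x\rangle\cong\mathbb{Z}$ generated by $x$. For $g\in G$ let $\mathrm{ev}_g:G*\langle x\rangle\to G$ be the unique homomorphism which sends $x$ to $g$ and is the identity on $G$. For $w\in G*\langle x\rangle$ put $E_w=\{g\in G:\mathrm{ev}_g(w)=1\}$. The Zariski topology $\mathfrak{Z}_G$ of $G$ is the coarsest topology on $G$ in which all sets $E_w$, $w\in G*\langle x\rangle$, are closed. The Markov topology $\mathfrak{M}_G$ of $G$ is the topology on $G$ whose closed sets are exactly the subsets of $G$ that are closed in every Hausdorff group topology on $G$. $\mathcal{MZ}$ denotes the class of all groups $G$ such that $\mathfrak{M}_G=\mathfrak{Z}_G$. *)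

theory Defs
  imports "HOL-Analysis.Analysis" "HOL-Algebra.Elementary_Groups" "HOL-Algebra.Coset"
begin

section \<open>Free products of two groups\<close>

text \<open>The free product is the monoid of words over the disjoint union of the two carriers,
  modulo the least congruence under which both inclusions become homomorphisms.\<close>

definition fp_words :: "('a, 'm) monoid_scheme \<Rightarrow> ('b, 'n) monoid_scheme \<Rightarrow> ('a + 'b) list set" where
  "fp_words G H = lists (carrier G <+> carrier H)"

inductive fp_eq ::
    "('a, 'm) monoid_scheme \<Rightarrow> ('b, 'n) monoid_scheme \<Rightarrow> ('a + 'b) list \<Rightarrow> ('a + 'b) list \<Rightarrow> bool"
  for G H where
  refl: "w \<in> fp_words G H \<Longrightarrow> fp_eq G H w w"
| sym: "fp_eq G H u v \<Longrightarrow> fp_eq G H v u"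
| trans: "fp_eq G H u v \<Longrightarrow> fp_eq G H v w \<Longrightarrow> fp_eq G H u w"
| append: "fp_eq G H u u' \<Longrightarrow> fp_eq G H v v' \<Longrightarrow> fp_eq G H (u @ v) (u' @ v')"
| one_left: "fp_eq G H [Inl \<one>\<^bsub>G\<^esub>] []"
| one_right: "fp_eq G H [Inr \<one>\<^bsub>H\<^esub>] []"
| mult_left: "a \<in> carrier G \<Longrightarrow> b \<in> carrier G \<Longrightarrow> fp_eq G H [Inl a, Inl b] [Inl (a \<otimes>\<^bsub>G\<^esub> b)]"
| mult_right: "a \<in> carrier H \<Longrightarrow> b \<in> carrier H \<Longrightarrow> fp_eq G H [Inr a, Inr b] [Inr (a \<otimes>\<^bsub>H\<^esub> b)]"

definition fp_rel ::
    "('a, 'm) monoid_scheme \<Rightarrow> ('b, 'n) monoid_scheme \<Rightarrow> (('a + 'b) list \<times> ('a + 'b) list) set" where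
  "fp_rel G H = {(u, v). fp_eq G H u v}"

definition fp_class ::
    "('a, 'm) monoid_scheme \<Rightarrow> ('b, 'n) monoid_scheme \<Rightarrow> ('a + 'b) list \<Rightarrow> ('a + 'b) list set" where
  "fp_class G H w = fp_rel G H `` {w}"

definition free_product ::
    "('a, 'm) monoid_scheme \<Rightarrow> ('b, 'n) monoid_scheme \<Rightarrow> ('a + 'b) list set monoid" where
  "free_product G H =
    \<lparr>carrier = fp_words G H // fp_rel G H,
     monoid.mult = (\<lambda>A B. \<Union>u\<in>A. \<Union>v\<in>B. fp_class G H (u @ v)),
     one = fp_class G H []\<rparr>"

lemma fp_words_simps [simp]:
  "[] \<in> fp_words G H"
  "Inl a # w \<in> fp_words G H \<longleftrightarrow> a \<in> carrier G \<and> w \<in> fp_words G H"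
  "Inr b # w \<in> fp_words G H \<longleftrightarrow> b \<in> carrier H \<and> w \<in> fp_words G H"
  "u @ v \<in> fp_words G H \<longleftrightarrow> u \<in> fp_words G H \<and> v \<in> fp_words G H"
  by (auto simp: fp_words_def)

lemma fp_eq_words:
  assumes "group G" "group H" "fp_eq G H u v"
  shows "u \<in> fp_words G H \<and> v \<in> fp_words G H"
proof -
  interpret G: group G by fact
  interpret H: group H by fact
  show ?thesis using assms(3) by induction auto
qed

lemma fp_rel_equiv:
  assumes "group G" "group H"
  shows "equiv (fp_words G H) (fp_rel G H)"
proof (rule equivI)
  show "fp_rel G H \<subseteq> fp_words G H \<times> fp_words G H"
    using fp_eq_words[OF assms] by (auto simp: fp_rel_def)
  show "refl_on (fp_words G H) (fp_rel G H)"
    by (rule refl_onI) (simp add: fp_rel_def fp_eq.refl)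
  show "sym (fp_rel G H)"
    by (rule symI) (unfold fp_rel_def mem_Collect_eq prod.case, rule fp_eq.sym)
  show "trans (fp_rel G H)"
    by (rule transI) (unfold fp_rel_def mem_Collect_eq prod.case, rule fp_eq.trans)
qed

lemma fp_class_eq_iff:
  assumes "group G" "group H" "u \<in> fp_words G H" "v \<in> fp_words G H"
  shows "fp_class G H u = fp_class G H v \<longleftrightarrow> fp_eq G H u v"
  using eq_equiv_class_iff[OF fp_rel_equiv[OF assms(1,2)] assms(3,4)]
  by (simp add: fp_class_def fp_rel_def)

lemma free_product_carrier:
  "carrier (free_product G H) = fp_class G H ` fp_words G H"
  by (auto simp: free_product_def quotient_def fp_class_def)

lemma free_product_one: "\<one>\<^bsub>free_product G H\<^esub> = fp_class G H []"
  by (simp add: free_product_def)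

lemma free_product_mult:
  assumes "group G" "group H" "u \<in> fp_words G H" "v \<in> fp_words G H"
  shows "fp_class G H u \<otimes>\<^bsub>free_product G H\<^esub> fp_class G H v = fp_class G H (u @ v)"
proof -
  define S where "S = fp_class G H (u @ v)"
  have *: "fp_class G H (u' @ v') = S"
    if "u' \<in> fp_class G H u" "v' \<in> fp_class G H v" for u' v'
  proof -
    have e: "fp_eq G H u u'" "fp_eq G H v v'"
      using that by (simp_all add: fp_class_def fp_rel_def)
    have "fp_eq G H (u' @ v') (u @ v)"
      by (rule fp_eq.append[OF fp_eq.sym[OF e(1)] fp_eq.sym[OF e(2)]])
    moreover from this have "u' @ v' \<in> fp_words G H" "u @ v \<in> fp_words G H"
      using fp_eq_words[OF assms(1,2)] by blast+
    ultimately show ?thesis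
      unfolding S_def using fp_class_eq_iff[OF assms(1,2)] by blast
  qed
  have mem: "u \<in> fp_class G H u" "v \<in> fp_class G H v"
    using assms by (simp_all add: fp_class_def fp_rel_def fp_eq.refl)
  have "(\<Union>u'\<in>fp_class G H u. \<Union>v'\<in>fp_class G H v. fp_class G H (u' @ v')) = S"
    using mem by (auto simp: *)
  then show ?thesis by (simp add: free_product_def S_def)
qed

lemma free_product_left_inverse:
  assumes "group G" "group H" "w \<in> fp_words G H"
  shows "\<exists>w' \<in> fp_words G H. fp_eq G H (w' @ w) []"
proof -
  interpret G: group G by fact
  interpret H: group H by fact
  have "\<exists>l' \<in> fp_words G H. fp_eq G H (l' @ [l]) []" if "l \<in> carrier G <+> carrier H" for l
  proof (cases l)
    case (Inl a)
    with that have a: "a \<in> carrier G" by auto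
    have "fp_eq G H [Inl (inv\<^bsub>G\<^esub> a), Inl a] [Inl \<one>\<^bsub>G\<^esub>]"
      using fp_eq.mult_left[of "inv\<^bsub>G\<^esub> a" G a H] a by simp
    then have "fp_eq G H ([Inl (inv\<^bsub>G\<^esub> a)] @ [l]) []"
      using Inl fp_eq.trans[OF _ fp_eq.one_left] by simp
    then show ?thesis using a by (intro bexI[of _ "[Inl (inv\<^bsub>G\<^esub> a)]"]) auto
  next
    case (Inr a)
    with that have a: "a \<in> carrier H" by auto
    have "fp_eq G H [Inr (inv\<^bsub>H\<^esub> a), Inr a] [Inr \<one>\<^bsub>H\<^esub>]"
      using fp_eq.mult_right[of "inv\<^bsub>H\<^esub> a" H a G] a by simp
    then have "fp_eq G H ([Inr (inv\<^bsub>H\<^esub> a)] @ [l]) []"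
      using Inr fp_eq.trans[OF _ fp_eq.one_right] by simp
    then show ?thesis using a by (intro bexI[of _ "[Inr (inv\<^bsub>H\<^esub> a)]"]) auto
  qed
  note single = this
  show ?thesis using assms(3)
  proof (induction w)
    case Nil
    then show ?case by (intro bexI[of _ "[]"]) (simp_all add: fp_eq.refl)
  next
    case (Cons l w)
    from Cons.prems have l: "l \<in> carrier G <+> carrier H" and w: "w \<in> fp_words G H"
      by (auto simp: fp_words_def)
    obtain l' where l': "l' \<in> fp_words G H" "fp_eq G H (l' @ [l]) []"
      using single[OF l] by blast
    obtain w' where w': "w' \<in> fp_words G H" "fp_eq G H (w' @ w) []"
      using Cons.IH[OF w] by blast
    have "fp_eq G H (w' @ ((l' @ [l]) @ w)) (w' @ ([] @ w))"
      using l' w w' by (intro fp_eq.append fp_eq.refl) auto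
    then have "fp_eq G H ((w' @ l') @ (l # w)) []"
      using fp_eq.trans[OF _ w'(2)] by simp
    then show ?case using l' w' by (intro bexI[of _ "w' @ l'"]) auto
  qed
qed

lemma group_free_product:
  assumes "group G" "group H"
  shows "group (free_product G H)"
proof (rule groupI)
  note simps = free_product_carrier free_product_one
  fix A B C
  assume A: "A \<in> carrier (free_product G H)"
  then obtain u where u: "u \<in> fp_words G H" "A = fp_class G H u" by (auto simp: simps)
  show "\<one>\<^bsub>free_product G H\<^esub> \<otimes>\<^bsub>free_product G H\<^esub> A = A"
    using u by (simp add: simps free_product_mult assms)
  obtain u' where u': "u' \<in> fp_words G H" "fp_eq G H (u' @ u) []"
    using free_product_left_inverse[OF assms u(1)] by blast
  then have "fp_class G H u' \<otimes>\<^bsub>free_product G H\<^esub> A = \<one>\<^bsub>free_product G H\<^esub>"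
    using u by (simp add: simps free_product_mult fp_class_eq_iff assms)
  then show "\<exists>y\<in>carrier (free_product G H). y \<otimes>\<^bsub>free_product G H\<^esub> A = \<one>\<^bsub>free_product G H\<^esub>"
    using u' by (auto simp: simps)
  assume B: "B \<in> carrier (free_product G H)"
  then obtain v where v: "v \<in> fp_words G H" "B = fp_class G H v" by (auto simp: simps)
  show "A \<otimes>\<^bsub>free_product G H\<^esub> B \<in> carrier (free_product G H)"
    using u v by (simp add: simps free_product_mult assms)
  assume "C \<in> carrier (free_product G H)"
  then obtain w where w: "w \<in> fp_words G H" "C = fp_class G H w" by (auto simp: simps)
  show "A \<otimes>\<^bsub>free_product G H\<^esub> B \<otimes>\<^bsub>free_product G H\<^esub> C =
        A \<otimes>\<^bsub>free_product G H\<^esub> (B \<otimes>\<^bsub>free_product G H\<^esub> C)"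
    using u v w by (simp add: free_product_mult assms)
qed (auto simp: free_product_carrier free_product_one)

fun fp_fold :: "('c, 'k) monoid_scheme \<Rightarrow> ('a \<Rightarrow> 'c) \<Rightarrow> ('b \<Rightarrow> 'c) \<Rightarrow> ('a + 'b) list \<Rightarrow> 'c" where
  "fp_fold K f g [] = \<one>\<^bsub>K\<^esub>"
| "fp_fold K f g (Inl a # w) = f a \<otimes>\<^bsub>K\<^esub> fp_fold K f g w"
| "fp_fold K f g (Inr b # w) = g b \<otimes>\<^bsub>K\<^esub> fp_fold K f g w"

lemma free_product_universal:
  assumes "group G" "group H" "group K" and f: "f \<in> hom G K" and g: "g \<in> hom H K"
  shows "\<exists>!h. h \<in> hom (free_product G H) K \<and> h \<in> extensional (carrier (free_product G H)) \<and>
           (\<forall>a\<in>carrier G. h (fp_class G H [Inl a]) = f a) \<and>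
           (\<forall>b\<in>carrier H. h (fp_class G H [Inr b]) = g b)"
    (is "\<exists>!h. ?P h")
proof -
  interpret G: group G by fact
  interpret H: group H by fact
  interpret K: group K by fact
  interpret F: group "free_product G H" by (rule group_free_product[OF assms(1,2)])
  have fK: "f a \<in> carrier K" if "a \<in> carrier G" for a using f that by (auto simp: hom_def)
  have gK: "g a \<in> carrier K" if "a \<in> carrier H" for a using g that by (auto simp: hom_def)
  have f1: "f \<one>\<^bsub>G\<^esub> = \<one>\<^bsub>K\<^esub>" using f hom_one assms(1,3) by blast
  have g1: "g \<one>\<^bsub>H\<^esub> = \<one>\<^bsub>K\<^esub>" using g hom_one assms(2,3) by blast
  let ?e = "fp_fold K f g"
  have cl: "?e w \<in> carrier K" if "w \<in> fp_words G H" for w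
    using that
  proof (induction w)
    case (Cons l w)
    then show ?case by (cases l) (auto simp: fK gK)
  qed simp
  have app: "?e (u @ v) = ?e u \<otimes>\<^bsub>K\<^esub> ?e v" if "u \<in> fp_words G H" "v \<in> fp_words G H" for u v
  proof -
    have "u \<in> fp_words G H \<Longrightarrow> ?thesis"
    proof (induction u)
      case Nil
      then show ?case using cl[OF that(2)] by simp
    next
      case (Cons l u)
      then show ?case using that(2) by (cases l) (auto simp: fK gK cl K.m_assoc)
    qed
    then show ?thesis using that by blast
  qed
  have resp: "?e u = ?e v" if "fp_eq G H u v" for u v
    using that
  proof induction
    case (append u u' v v')
    then show ?case using fp_eq_words[OF assms(1,2)] app by metis
  next
    case (mult_left a b)
    then show ?case using f fK by (auto simp: hom_def)
  next
    case (mult_right a b)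
    then show ?case using g gK by (auto simp: hom_def)
  qed (auto simp: f1 g1)
  define h where "h = restrict (\<lambda>A. ?e (SOME w. w \<in> A)) (carrier (free_product G H))"
  have h: "h (fp_class G H w) = ?e w" if w: "w \<in> fp_words G H" for w
  proof -
    have "w \<in> fp_class G H w" using w by (simp add: fp_class_def fp_rel_def fp_eq.refl)
    then have "(SOME v. v \<in> fp_class G H w) \<in> fp_class G H w" by (rule someI)
    then have "fp_eq G H w (SOME v. v \<in> fp_class G H w)"
      by (auto simp: fp_class_def fp_rel_def)
    from resp[OF this] show ?thesis using w by (simp add: h_def free_product_carrier)
  qed
  have "?P h"
  proof (intro conjI ballI)
    show "h \<in> hom (free_product G H) K"
      by (rule homI) (auto simp: free_product_carrier free_product_mult assms(1,2) h cl app)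
    show "h \<in> extensional (carrier (free_product G H))" by (simp add: h_def)
  qed (auto simp: h fK gK)
  moreover have "k = h" if k: "?P k" for k
  proof (rule extensionalityI[of _ "carrier (free_product G H)"])
    fix A assume "A \<in> carrier (free_product G H)"
    then obtain w where w: "w \<in> fp_words G H" "A = fp_class G H w"
      by (auto simp: free_product_carrier)
    have kh: "k \<in> hom (free_product G H) K" using k by blast
    have step: "k (fp_class G H (l # w)) = k (fp_class G H [l]) \<otimes>\<^bsub>K\<^esub> k (fp_class G H w)"
      if "[l] \<in> fp_words G H" "w \<in> fp_words G H" for l w
    proof -
      have "fp_class G H (l # w) = fp_class G H [l] \<otimes>\<^bsub>free_product G H\<^esub> fp_class G H w"
        using that by (simp add: free_product_mult assms(1,2))
      then show ?thesis using hom_mult[OF kh] that by (simp add: free_product_carrier)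
    qed
    have "w \<in> fp_words G H \<Longrightarrow> k (fp_class G H w) = ?e w" for w
    proof (induction w)
      case Nil
      then show ?case
        using hom_one[OF kh] F.group_axioms assms(3) by (simp add: free_product_one)
    next
      case (Cons l w)
      then have lw: "[l] \<in> fp_words G H" "w \<in> fp_words G H" by (auto simp: fp_words_def)
      have "k (fp_class G H [l]) = ?e [l]"
        using k lw(1) by (cases l) (auto simp: fK gK)
      moreover have "?e (l # w) = ?e [l] \<otimes>\<^bsub>K\<^esub> ?e w"
        using app[OF lw] by simp
      ultimately show ?case
        unfolding step[OF lw] using Cons.IH[OF lw(2)] by simp
    qed
    then show "k A = h A" using w h by simp
  qed (use k in \<open>auto simp: h_def\<close>)
  ultimately show ?thesis by blast
qed

section \<open>The Zariski topology\<close>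

text \<open>Words in one variable: \<open>G * \<langle>x\<rangle>\<close>, where \<open>\<langle>x\<rangle>\<close> is the infinite cyclic group
  \<^const>\<open>integer_group\<close> with generator \<open>1\<close>.\<close>

abbreviation words :: "('a, 'm) monoid_scheme \<Rightarrow> ('a + int) list set monoid" where
  "words G \<equiv> free_product G integer_group"

definition word_const :: "('a, 'm) monoid_scheme \<Rightarrow> 'a \<Rightarrow> ('a + int) list set" where
  "word_const G a = fp_class G integer_group [Inl a]"

definition word_var :: "('a, 'm) monoid_scheme \<Rightarrow> ('a + int) list set" where
  "word_var G = fp_class G integer_group [Inr 1]"

text \<open>Extensionality only fixes the irrelevant values outside the carrier, so that the
  homomorphism is unique as a HOL function.\<close>

definition is_ev :: "('a, 'm) monoid_scheme \<Rightarrow> 'a \<Rightarrow> (('a + int) list set \<Rightarrow> 'a) \<Rightarrow> bool" where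
  "is_ev G g h \<longleftrightarrow>
     h \<in> hom (words G) G \<and> h \<in> extensional (carrier (words G)) \<and>
     (\<forall>a\<in>carrier G. h (word_const G a) = a) \<and> h (word_var G) = g"

definition ev :: "('a, 'm) monoid_scheme \<Rightarrow> 'a \<Rightarrow> ('a + int) list set \<Rightarrow> 'a" where
  "ev G g = (THE h. is_ev G g h)"

lemma ex1_ev:
  assumes "group G" "g \<in> carrier G"
  shows "\<exists>!h. is_ev G g h"
proof -
  interpret G: group G by fact
  interpret W: group "words G"
    by (rule group_free_product[OF assms(1) group_integer_group])
  have pow: "(\<lambda>k::int. g [^]\<^bsub>G\<^esub> k) \<in> hom integer_group G"
    using assms(2) by (auto simp: hom_def G.int_pow_mult)
  have id: "(\<lambda>a. a) \<in> hom G G" by (auto simp: hom_def)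
  have "is_ev G g h \<longleftrightarrow>
      h \<in> hom (words G) G \<and> h \<in> extensional (carrier (words G)) \<and>
      (\<forall>a\<in>carrier G. h (fp_class G integer_group [Inl a]) = a) \<and>
      (\<forall>k\<in>carrier integer_group. h (fp_class G integer_group [Inr k]) = g [^]\<^bsub>G\<^esub> k)" for h
  proof (cases "h \<in> hom (words G) G")
    case True
    have "(\<lambda>k. fp_class G integer_group [Inr k]) \<in> hom integer_group (words G)"
    proof (rule homI)
      fix k l :: int
      have "fp_eq G integer_group [Inr k, Inr l] [Inr (k + l)]"
        using fp_eq.mult_right[of k integer_group l G] by simp
      then show "fp_class G integer_group [Inr (k \<otimes>\<^bsub>integer_group\<^esub> l)] =
          fp_class G integer_group [Inr k] \<otimes>\<^bsub>words G\<^esub> fp_class G integer_group [Inr l]"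
        using assms by (simp add: free_product_mult fp_class_eq_iff) (rule fp_eq.sym)
    qed (simp add: free_product_carrier)
    then have "(\<lambda>k. h (fp_class G integer_group [Inr k])) \<in> hom integer_group G"
      using True unfolding hom_def by (auto simp: Pi_iff)
    then interpret h: group_hom integer_group G "\<lambda>k. h (fp_class G integer_group [Inr k])"
      by (intro group_hom.intro group_hom_axioms.intro) (auto simp: assms)
    have "(1::int) [^]\<^bsub>integer_group\<^esub> n = int n" for n :: nat
      by (induction n) (simp_all add: nat_pow_def)
    then have one: "(1::int) [^]\<^bsub>integer_group\<^esub> k = k" for k :: int
      by (simp add: int_pow_def2)
    have "h (fp_class G integer_group [Inr k]) = h (fp_class G integer_group [Inr 1]) [^]\<^bsub>G\<^esub> k" for k
      using h.hom_int_pow[of 1 k] by (simp add: one)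
    note pw = this
    have g1: "g [^]\<^bsub>G\<^esub> (1::int) = g" using assms by (simp add: G.int_pow_1)
    have "h (fp_class G integer_group [Inr 1]) = g \<longleftrightarrow>
        (\<forall>k\<in>carrier integer_group. h (fp_class G integer_group [Inr k]) = g [^]\<^bsub>G\<^esub> k)"
    proof
      assume e: "h (fp_class G integer_group [Inr 1]) = g"
      show "\<forall>k\<in>carrier integer_group. h (fp_class G integer_group [Inr k]) = g [^]\<^bsub>G\<^esub> k"
        by (intro ballI, subst pw, unfold e, rule HOL.refl)
    next
      assume e: "\<forall>k\<in>carrier integer_group. h (fp_class G integer_group [Inr k]) = g [^]\<^bsub>G\<^esub> k"
      show "h (fp_class G integer_group [Inr 1]) = g"
        using e[rule_format, of 1] g1 by simp
    qed
    then show ?thesis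
      unfolding is_ev_def word_const_def word_var_def by blast
  qed (simp add: is_ev_def)
  then show ?thesis
    using free_product_universal[OF assms(1) group_integer_group assms(1) id pow] by simp
qed

lemma is_ev_ev:
  assumes "group G" "g \<in> carrier G"
  shows "is_ev G g (ev G g)"
  unfolding ev_def by (rule theI'[OF ex1_ev[OF assms]])

definition elementary_algebraic :: "('a, 'm) monoid_scheme \<Rightarrow> ('a + int) list set \<Rightarrow> 'a set" where
  "elementary_algebraic G w = {g \<in> carrier G. ev G g w = \<one>\<^bsub>G\<^esub>}"

text \<open>The coarsest topology on the carrier with all the sets \<open>E_w\<close> closed. The carrier is put into
  the subbase explicitly since for a trivial group every \<open>carrier G - E_w\<close> is empty.\<close>

definition zariski_topology :: "('a, 'm) monoid_scheme \<Rightarrow> 'a topology" where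
  "zariski_topology G =
     topology_generated_by
       (insert (carrier G) {carrier G - elementary_algebraic G w |w. w \<in> carrier (words G)})"

lemma topspace_zariski_topology [simp]: "topspace (zariski_topology G) = carrier G"
  by (auto simp: zariski_topology_def)

lemma closedin_zariski_elementary:
  assumes "w \<in> carrier (words G)"
  shows "closedin (zariski_topology G) (elementary_algebraic G w)"
proof -
  have "openin (zariski_topology G) (carrier G - elementary_algebraic G w)"
    unfolding zariski_topology_def using assms by (intro topology_generated_by_Basis) blast
  then show ?thesis by (auto simp: closedin_def elementary_algebraic_def)
qed

lemma zariski_topology_coarsest:
  assumes "topspace T = carrier G"
    and "\<And>w. w \<in> carrier (words G) \<Longrightarrow> closedin T (elementary_algebraic G w)"
    and "openin (zariski_topology G) U"
  shows "openin T U"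
proof -
  have "generate_topology_on
      (insert (carrier G) {carrier G - elementary_algebraic G w |w. w \<in> carrier (words G)}) U"
    using assms(3) by (simp add: zariski_topology_def openin_topology_generated_by_iff)
  then show ?thesis
  proof induction
    case (Basis s)
    then show ?case using assms(1,2) openin_topspace[of T] by (auto simp: closedin_def)
  qed auto
qed

section \<open>The Markov topology\<close>

definition hausdorff_group_topology :: "('a, 'm) monoid_scheme \<Rightarrow> 'a topology \<Rightarrow> bool" where
  "hausdorff_group_topology G T \<longleftrightarrow>
     topspace T = carrier G \<and> Hausdorff_space T \<and>
     continuous_map (prod_topology T T) T (\<lambda>(a, b). a \<otimes>\<^bsub>G\<^esub> b) \<and>
     continuous_map T T (\<lambda>a. inv\<^bsub>G\<^esub> a)"

definition markov_topology :: "('a, 'm) monoid_scheme \<Rightarrow> 'a topology" where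
  "markov_topology G =
     topology (\<lambda>U. U \<subseteq> carrier G \<and>
       (\<forall>T. hausdorff_group_topology G T \<longrightarrow> closedin T (carrier G - U)))"

lemma openin_markov_topology:
  "openin (markov_topology G) U \<longleftrightarrow>
     U \<subseteq> carrier G \<and> (\<forall>T. hausdorff_group_topology G T \<longrightarrow> closedin T (carrier G - U))"
proof -
  have *: "U \<subseteq> carrier G \<and> (\<forall>T. hausdorff_group_topology G T \<longrightarrow> closedin T (carrier G - U)) \<longleftrightarrow>
        U \<subseteq> carrier G \<and> (\<forall>T. hausdorff_group_topology G T \<longrightarrow> openin T U)" for U
    by (auto simp: hausdorff_group_topology_def openin_closedin_eq)
  have "istopology (\<lambda>U. U \<subseteq> carrier G \<and> (\<forall>T. hausdorff_group_topology G T \<longrightarrow> openin T U))"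
    unfolding istopology_def by (auto intro!: openin_Int openin_Union)
  then show ?thesis unfolding markov_topology_def * by (subst topology_inverse') auto
qed

lemma topspace_markov_topology [simp]: "topspace (markov_topology G) = carrier G"
  unfolding topspace_def by (auto simp: openin_markov_topology intro!: exI[of _ "carrier G"])

lemma closedin_markov_topology:
  "closedin (markov_topology G) C \<longleftrightarrow>
     C \<subseteq> carrier G \<and> (\<forall>T. hausdorff_group_topology G T \<longrightarrow> closedin T C)"
  by (auto simp: closedin_def[of "markov_topology G"] openin_markov_topology double_diff)

section \<open>The class \<open>\<M>\<Z>\<close>\<close>

text \<open>HOL cannot quantify existentially over types, so existence claims about this class have to
  fix an ambient type for the carriers; \<^typ>\<open>real set\<close> has room for every group of cardinality
  at most \<open>2 ^ continuum\<close>, up to isomorphism.\<close>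

definition MZ :: "('a, 'm) monoid_scheme \<Rightarrow> bool" where
  "MZ G \<longleftrightarrow> group G \<and> markov_topology G = zariski_topology G"

end

theory Submission
  imports Defs "HOL-Combinatorics.Transposition" "HOL-Library.FSet" "HOL-Algebra.Weak_Morphisms"
begin

text \<open>Two facts combine. First, every group \<open>H\<close> is a quotient of a group in \<open>\<M>\<Z>\<close>; second, some group
  is not in \<open>\<M>\<Z>\<close>.

  For the first, a group of permutations of an infinite set that contains all transpositions is in
  \<open>\<M>\<Z>\<close>: the topology of pointwise convergence is a Hausdorff group topology on it, so it refines the
  Markov topology, and it is coarser than the Zariski topology because "\<open>g a = b\<close>" can be enforced
  near a given \<open>g\<close> by finitely many conditions of the form "the transposition \<open>g t g\<inverse>\<close> does not
  commute with the transposition \<open>s\<close>" (\<open>openin_zariski_act_eq\<close>). If \<open>H\<close> acts on an infinite set in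
  such a way that each non-identity element moves infinitely many points, then the permutations that
  differ at finitely many points from the action of some element of \<open>H\<close> form such a group, and it
  maps onto \<open>H\<close> with the finitely supported permutations as kernel.

  For the second, take a Heisenberg group over the two-element field, with central
  involution \<open>c\<close>; any two of its elements commute or anticommute (where \<open>u\<close>, \<open>v\<close> anticommute if
  \<open>u v = c v u\<close>). It contains involutions \<open>a\<close> indexed by points of \<open>\<nat> \<times> \<nat>\<close>, two of which anticommute
  exactly if they lie in the same column, and for each set \<open>D\<close> with finite columns an element \<open>e D\<close>
  that anticommutes with \<open>a x\<close> exactly if \<open>x \<in> D\<close>. The set of all \<open>a x\<close> is closed in each Hausdorff
  group topology: by joint continuity of the commutator, each point \<open>p\<close> has a neighbourhood in which
  no two elements anticommute; the \<open>a x\<close> in it have at most one index per column, and so all but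
  finitely many of them are separated from \<open>p\<close> by a single \<open>e D\<close>. The set \<open>D\<close> depends on the
  topology, and finitely many sets \<open>D\<close> never suffice: they leave infinitely many points in each column, so
  each Zariski neighbourhood of the identity contains some \<open>a x\<close>, and the set is not Zariski closed.

  This Heisenberg group acts on a countable set like the Schroedinger representation, by translations
  and changes of sign, with infinitely many points moved by each non-identity element.\<close>

section \<open>Words as functions on the group\<close>

abbreviation eval_word :: "('a, 'm) monoid_scheme \<Rightarrow> ('a + int) list \<Rightarrow> 'a \<Rightarrow> 'a" where
  "eval_word G u g \<equiv> fp_fold G (\<lambda>a. a) (\<lambda>k::int. g [^]\<^bsub>G\<^esub> k) u"

lemma fp_words_integer_induct [consumes 1, case_names Nil Inl Inr]:
  assumes "u \<in> fp_words G integer_group"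
    and "P []"
    and "\<And>a u. \<lbrakk>a \<in> carrier G; u \<in> fp_words G integer_group; P u\<rbrakk> \<Longrightarrow> P (Inl a # u)"
    and "\<And>k u. \<lbrakk>u \<in> fp_words G integer_group; P u\<rbrakk> \<Longrightarrow> P (Inr k # u)"
  shows "P u"
  using assms(1)
proof (induction u)
  case (Cons l u)
  then show ?case using assms(3,4) by (cases l) auto
qed (rule assms(2))

lemma (in group) eval_word_closed:
  assumes "g \<in> carrier G" "u \<in> fp_words G integer_group"
  shows "eval_word G u g \<in> carrier G"
  using assms(2) by (induction rule: fp_words_integer_induct) (use assms(1) in auto)

text \<open>The evaluation homomorphism is given by its uniqueness only; on a class of the free product it is
  computed letter by letter, by comparing it with the homomorphism from the universal property.\<close>

lemma ev_fp_class:
  assumes "group G" "g \<in> carrier G" "u \<in> fp_words G integer_group"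
  shows "ev G g (fp_class G integer_group u) = eval_word G u g"
proof -
  interpret G: group G by fact
  have id: "(\<lambda>a. a) \<in> hom G G"
    by (auto simp: hom_def)
  have pow: "(\<lambda>k::int. g [^]\<^bsub>G\<^esub> k) \<in> hom integer_group G"
    using assms(2) by (auto simp: hom_def G.int_pow_mult)
  obtain h where h: "h \<in> hom (words G) G" "h \<in> extensional (carrier (words G))"
    "\<And>a. a \<in> carrier G \<Longrightarrow> h (fp_class G integer_group [Inl a]) = a"
    "\<And>k. h (fp_class G integer_group [Inr k]) = g [^]\<^bsub>G\<^esub> k"
    using free_product_universal[OF assms(1) group_integer_group assms(1) id pow] by auto
  have "is_ev G g h"
    using h assms(2) by (auto simp: is_ev_def word_const_def word_var_def G.int_pow_1)
  then have ev: "ev G g = h"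
    using ex1_ev[OF assms(1,2)] is_ev_ev[OF assms(1,2)] by blast
  have cons: "h (fp_class G integer_group (l # v)) =
      h (fp_class G integer_group [l]) \<otimes>\<^bsub>G\<^esub> h (fp_class G integer_group v)"
    if "[l] \<in> fp_words G integer_group" "v \<in> fp_words G integer_group" for l v
    using hom_mult[OF h(1), of "fp_class G integer_group [l]" "fp_class G integer_group v"]
      free_product_mult[OF assms(1) group_integer_group that] that
    by (simp add: free_product_carrier)
  have "h (fp_class G integer_group u) = eval_word G u g"
    using assms(3)
  proof (induction rule: fp_words_integer_induct)
    case Nil
    have "h \<one>\<^bsub>words G\<^esub> = \<one>\<^bsub>G\<^esub>"
      using hom_one[OF h(1)] group_free_product[OF assms(1) group_integer_group] assms(1) by simp
    then show ?case by (simp add: free_product_one)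
  next
    case (Inl a u)
    then show ?case using cons[of "Inl a" u] h(3) by simp
  next
    case (Inr k u)
    then show ?case using cons[of "Inr k" u] h(4) by simp
  qed
  then show ?thesis by (simp add: ev)
qed

lemma elementary_algebraic_fp_class:
  assumes "group G" "u \<in> fp_words G integer_group"
  shows "elementary_algebraic G (fp_class G integer_group u) =
    {g \<in> carrier G. eval_word G u g = \<one>\<^bsub>G\<^esub>}"
  using assms by (auto simp: elementary_algebraic_def ev_fp_class)

lemma closedin_zariski_eval_word:
  assumes "group G" "u \<in> fp_words G integer_group"
  shows "closedin (zariski_topology G) {g \<in> carrier G. eval_word G u g = \<one>\<^bsub>G\<^esub>}"
  using closedin_zariski_elementary[of "fp_class G integer_group u" G] assms
  by (simp add: elementary_algebraic_fp_class free_product_carrier)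

text \<open>With representing words in place of classes, arguments about the Zariski topology can proceed by
  induction on lists of letters.\<close>

lemma zariski_open_coarsest:
  assumes "group G" "topspace T = carrier G"
    and "\<And>u. u \<in> fp_words G integer_group \<Longrightarrow>
           closedin T {g \<in> carrier G. eval_word G u g = \<one>\<^bsub>G\<^esub>}"
    and "openin (zariski_topology G) U"
  shows "openin T U"
  using assms(2)
proof (rule zariski_topology_coarsest[OF _ _ assms(4)])
  fix w assume "w \<in> carrier (words G)"
  then show "closedin T (elementary_algebraic G w)"
    using assms(3) by (auto simp: free_product_carrier elementary_algebraic_fp_class[OF assms(1)])
qed

section \<open>Hausdorff group topologies\<close>

lemma continuous_map_group_mult:
  assumes "hausdorff_group_topology G T" "continuous_map X T f" "continuous_map X T f'"
  shows "continuous_map X T (\<lambda>x. f x \<otimes>\<^bsub>G\<^esub> f' x)"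
proof -
  have "continuous_map X T ((\<lambda>(a, b). a \<otimes>\<^bsub>G\<^esub> b) \<circ> (\<lambda>x. (f x, f' x)))"
    using assms unfolding hausdorff_group_topology_def
    by (intro continuous_map_compose[of _ "prod_topology T T"] continuous_map_pairedI) auto
  then show ?thesis by (simp add: o_def)
qed

lemma continuous_map_group_inv:
  assumes "hausdorff_group_topology G T" "continuous_map X T f"
  shows "continuous_map X T (\<lambda>x. inv\<^bsub>G\<^esub> (f x))"
  using continuous_map_compose[OF assms(2), of T "\<lambda>a. inv\<^bsub>G\<^esub> a"] assms(1)
  by (simp add: hausdorff_group_topology_def o_def)

lemma continuous_map_group_nat_pow:
  assumes "group G" "hausdorff_group_topology G T" "continuous_map X T f"
  shows "continuous_map X T (\<lambda>x. f x [^]\<^bsub>G\<^esub> (n::nat))"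
proof (induction n)
  case 0
  interpret G: group G by fact
  show ?case using assms(2) by (simp add: hausdorff_group_topology_def)
next
  case (Suc n)
  then show ?case using continuous_map_group_mult[OF assms(2) Suc assms(3)] by (simp add: nat_pow_def)
qed

lemma continuous_map_eval_word:
  assumes "group G" "hausdorff_group_topology G T" "u \<in> fp_words G integer_group"
  shows "continuous_map T T (eval_word G u)"
proof -
  interpret G: group G by fact
  have T: "topspace T = carrier G" using assms(2) by (simp add: hausdorff_group_topology_def)
  show ?thesis using assms(3)
  proof (induction rule: fp_words_integer_induct)
    case Nil
    then show ?case using T by simp
  next
    case (Inl a u)
    then show ?case
      using continuous_map_group_mult[OF assms(2), of T "\<lambda>_. a"] T by simp
  next
    case (Inr k u)
    have id: "continuous_map T T (\<lambda>x. x)" using continuous_map_id[of T] by (simp add: id_def)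
    have "continuous_map T T (\<lambda>g. g [^]\<^bsub>G\<^esub> k)"
      unfolding int_pow_def2
      using continuous_map_group_nat_pow[OF assms(1,2) id]
        continuous_map_group_inv[OF assms(2) continuous_map_group_nat_pow[OF assms(1,2) id]]
      by (cases "k < 0") (simp_all only: if_True if_False)
    then show ?case
      using continuous_map_group_mult[OF assms(2) _ Inr(2)] by simp
  qed
qed

text \<open>A solution set of an equation is closed in every Hausdorff group topology, as words act
  continuously. Thus membership in \<open>\<M>\<Z>\<close> is a matter of the other inclusion only.\<close>

lemma zariski_open_imp_markov_open:
  assumes "group G" "openin (zariski_topology G) U"
  shows "openin (markov_topology G) U"
proof (rule zariski_open_coarsest[OF assms(1) _ _ assms(2)])
  interpret G: group G by fact
  fix u assume u: "u \<in> fp_words G integer_group"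
  have "closedin T {g \<in> carrier G. eval_word G u g = \<one>\<^bsub>G\<^esub>}"
    if T: "hausdorff_group_topology G T" for T
  proof -
    have "closedin T {g \<in> topspace T. eval_word G u g = \<one>\<^bsub>G\<^esub>}"
      using T continuous_map_eval_word[OF assms(1) T u]
      by (intro closedin_continuous_maps_eq[of T]) (auto simp: hausdorff_group_topology_def)
    then show ?thesis using T by (simp add: hausdorff_group_topology_def)
  qed
  then show "closedin (markov_topology G) {g \<in> carrier G. eval_word G u g = \<one>\<^bsub>G\<^esub>}"
    by (auto simp: closedin_markov_topology)
qed simp

lemma MZ_I:
  assumes "group G"
    and "\<And>U. openin (markov_topology G) U \<Longrightarrow> openin (zariski_topology G) U"
  shows "MZ G"
  using assms zariski_open_imp_markov_open[OF assms(1)] by (auto simp: MZ_def topology_eq)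

section \<open>Isomorphism invariance\<close>

lemma eval_word_iso:
  assumes "group G" "group K" "h \<in> iso G K" "g \<in> carrier G" "u \<in> fp_words G integer_group"
  shows "map (map_sum h id) u \<in> fp_words K integer_group"
    and "h (eval_word G u g) = eval_word K (map (map_sum h id) u) (h g)"
proof -
  interpret G: group G by fact
  interpret K: group K by fact
  interpret h: group_hom G K h
    using assms(3) by unfold_locales (auto simp: iso_def)
  have "map (map_sum h id) u \<in> fp_words K integer_group \<and>
    h (eval_word G u g) = eval_word K (map (map_sum h id) u) (h g)"
    using assms(5)
    by (induction rule: fp_words_integer_induct)
      (use assms(4) G.eval_word_closed[OF assms(4)] in \<open>auto simp: h.hom_int_pow\<close>)
  then show "map (map_sum h id) u \<in> fp_words K integer_group"
    and "h (eval_word G u g) = eval_word K (map (map_sum h id) u) (h g)" by auto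
qed

text \<open>The Zariski topology of \<open>K\<close> pulled back along the isomorphism has all solution sets of \<open>G\<close>
  closed, since words over \<open>G\<close> translate to words over \<open>K\<close>; so it refines the Zariski topology of \<open>G\<close>.\<close>

lemma zariski_open_iso_image:
  assumes "group G" "group K" "h \<in> iso G K" "openin (zariski_topology G) V"
  shows "openin (zariski_topology K) (h ` V)"
proof -
  interpret G: group G by fact
  interpret K: group K by fact
  have h: "bij_betw h (carrier G) (carrier K)" "h \<one>\<^bsub>G\<^esub> = \<one>\<^bsub>K\<^esub>"
    using assms(3) hom_one[OF _ assms(1,2)] by (auto simp: iso_def)
  have inj: "inj_on h (carrier G)" and im: "h ` carrier G = carrier K"
    using h by (auto simp: bij_betw_def)
  let ?T = "pullback_topology (carrier G) h (zariski_topology K)"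
  have top: "topspace ?T = carrier G"
    using im by (auto simp: topspace_pullback_topology)
  have "openin ?T V"
  proof (rule zariski_open_coarsest[OF assms(1) top _ assms(4)])
    fix u assume u: "u \<in> fp_words G integer_group"
    let ?u' = "map (map_sum h id) u"
    have "continuous_map ?T (zariski_topology K) (id \<circ> h)"
      by (intro continuous_map_pullback) simp
    then have cont: "continuous_map ?T (zariski_topology K) h" by simp
    have "closedin (zariski_topology K) {g \<in> carrier K. eval_word K ?u' g = \<one>\<^bsub>K\<^esub>}"
      using closedin_zariski_eval_word[OF assms(2) eval_word_iso(1)[OF assms(1-3) _ u]] G.one_closed
      by blast
    from closedin_continuous_map_preimage[OF cont this]
    have "closedin ?T {g \<in> carrier G. eval_word K ?u' (h g) = \<one>\<^bsub>K\<^esub>}"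
      using top im by (auto elim!: back_subst[of "closedin ?T"])
    also have "{g \<in> carrier G. eval_word K ?u' (h g) = \<one>\<^bsub>K\<^esub>} = {g \<in> carrier G. eval_word G u g = \<one>\<^bsub>G\<^esub>}"
    proof (intro Collect_cong conj_cong HOL.refl)
      fix g assume g: "g \<in> carrier G"
      show "eval_word K ?u' (h g) = \<one>\<^bsub>K\<^esub> \<longleftrightarrow> eval_word G u g = \<one>\<^bsub>G\<^esub>"
        using eval_word_iso(2)[OF assms(1-3) g u] inj_onD[OF inj, of "eval_word G u g" "\<one>\<^bsub>G\<^esub>"]
          G.eval_word_closed[OF g u] h(2) by auto
    qed
    finally show "closedin ?T {g \<in> carrier G. eval_word G u g = \<one>\<^bsub>G\<^esub>}" .
  qed
  then obtain W where W: "openin (zariski_topology K) W" "V = h -` W \<inter> carrier G"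
    by (auto simp: openin_pullback_topology)
  have "W \<subseteq> carrier K" using openin_subset[OF W(1)] by simp
  moreover have "h ` (h -` W \<inter> carrier G) = W \<inter> h ` carrier G" by auto
  ultimately have "h ` V = W" using W(2) im by auto
  then show ?thesis using W(1) by simp
qed

lemma hausdorff_group_topology_pullback:
  assumes "group G" "group K" "k \<in> iso K G" "hausdorff_group_topology G T"
  shows "hausdorff_group_topology K (pullback_topology (carrier K) k T)" (is "hausdorff_group_topology K ?T")
proof -
  interpret G: group G by fact
  interpret K: group K by fact
  interpret k: group_hom K G k
    using assms(3) by unfold_locales (auto simp: iso_def)
  have T: "topspace T = carrier G" "Hausdorff_space T"
    using assms(4) by (auto simp: hausdorff_group_topology_def)
  have top: "topspace ?T = carrier K"
    using T by (auto simp: topspace_pullback_topology)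
  have inj: "inj_on k (carrier K)"
    using assms(3) by (auto simp: iso_def bij_betw_def)
  have "continuous_map ?T T (id \<circ> k)"
    by (intro continuous_map_pullback) simp
  then have k: "continuous_map ?T T k" by simp
  have "Hausdorff_space ?T"
    unfolding Hausdorff_space_def
  proof (intro allI impI)
    fix x y assume xy: "x \<in> topspace ?T \<and> y \<in> topspace ?T \<and> x \<noteq> y"
    then have "k x \<in> topspace T" "k y \<in> topspace T" "k x \<noteq> k y"
      using inj T top by (auto dest: inj_onD)
    then obtain U V where UV: "openin T U" "openin T V" "k x \<in> U" "k y \<in> V" "disjnt U V"
      using T(2) unfolding Hausdorff_space_def by metis
    show "\<exists>U V. openin ?T U \<and> openin ?T V \<and> x \<in> U \<and> y \<in> V \<and> disjnt U V"
      using UV xy top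
      by (intro exI[of _ "k -` U \<inter> carrier K"] exI[of _ "k -` V \<inter> carrier K"])
        (auto simp: openin_pullback_topology disjnt_def)
  qed
  moreover have "continuous_map (prod_topology ?T ?T) ?T (\<lambda>(a, b). a \<otimes>\<^bsub>K\<^esub> b)"
  proof (rule continuous_map_pullback')
    have "continuous_map (prod_topology ?T ?T) T (\<lambda>x. (k \<circ> fst) x \<otimes>\<^bsub>G\<^esub> (k \<circ> snd) x)"
      by (intro continuous_map_group_mult[OF assms(4)] continuous_map_compose[OF _ k]
          continuous_map_fst continuous_map_snd)
    then show "continuous_map (prod_topology ?T ?T) T (k \<circ> (\<lambda>(a, b). a \<otimes>\<^bsub>K\<^esub> b))"
      by (rule continuous_map_eq) (auto simp: top)
  qed (auto simp: top)
  moreover have "continuous_map ?T ?T (\<lambda>a. inv\<^bsub>K\<^esub> a)"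
  proof (rule continuous_map_pullback')
    show "continuous_map ?T T (k \<circ> (\<lambda>a. inv\<^bsub>K\<^esub> a))"
      using continuous_map_group_inv[OF assms(4) k]
      by (rule continuous_map_eq) (auto simp: top)
  qed (auto simp: top)
  ultimately show ?thesis
    using top by (simp add: hausdorff_group_topology_def)
qed

lemma MZ_iso:
  assumes "MZ G" "group K" "G \<cong> K"
  shows "MZ K"
proof -
  interpret G: group G using assms(1) by (simp add: MZ_def)
  interpret K: group K by fact
  obtain h where h: "h \<in> iso G K" using assms(3) by (auto simp: is_iso_def)
  then have bij: "bij_betw h (carrier G) (carrier K)" by (simp add: iso_def)
  define k where "k = inv_into (carrier G) h"
  have k: "k \<in> iso K G" unfolding k_def by (rule G.iso_set_sym[OF h])
  have kh: "k (h g) = g" if "g \<in> carrier G" for g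
    using bij that by (auto simp: k_def bij_betw_def)
  show ?thesis
  proof (rule MZ_I[OF assms(2)])
    fix U assume U: "openin (markov_topology K) U"
    define V where "V = {g \<in> carrier G. h g \<in> U}"
    have UK: "U \<subseteq> carrier K" using openin_subset[OF U] by simp
    have "openin T V" if T: "hausdorff_group_topology G T" for T
    proof -
      let ?T = "pullback_topology (carrier K) k T"
      have "hausdorff_group_topology K ?T"
        by (rule hausdorff_group_topology_pullback[OF G.group_axioms assms(2) k T])
      then have "closedin ?T (carrier K - U)" "topspace ?T = carrier K"
        using U by (auto simp: openin_markov_topology hausdorff_group_topology_def)
      then have "openin ?T U" using UK by (simp add: openin_closedin_eq)
      then obtain W where W: "openin T W" "U = k -` W \<inter> carrier K"
        by (auto simp: openin_pullback_topology)
      have "W \<subseteq> carrier G"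
        using openin_subset[OF W(1)] T by (simp add: hausdorff_group_topology_def)
      then have "V = W"
        using W(2) kh bij by (auto simp: V_def bij_betw_def)
      then show ?thesis using W(1) by simp
    qed
    then have "openin (markov_topology G) V"
      by (auto simp: openin_markov_topology V_def hausdorff_group_topology_def closedin_def double_diff)
    then have "openin (zariski_topology G) V" using assms(1) by (simp add: MZ_def)
    then have "openin (zariski_topology K) (h ` V)"
      by (rule zariski_open_iso_image[OF G.group_axioms assms(2) h])
    moreover have "h ` V = U" using UK bij by (auto simp: V_def bij_betw_def)
    ultimately show "openin (zariski_topology K) U" by simp
  qed
qed

section \<open>Groups of permutations containing all transpositions\<close>

text \<open>Faithfulness makes \<open>G\<close> a permutation group. As transpositions generate the finitely
  supported permutations, the last assumption says that \<open>G\<close> contains all of these.\<close>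

locale permutation_group = group G for G (structure) +
  fixes act :: "'a \<Rightarrow> 'x \<Rightarrow> 'x"
  assumes infinite_points: "infinite (UNIV :: 'x set)"
    and act_one [simp]: "act \<one> x = x"
    and act_mult [simp]: "\<lbrakk>g \<in> carrier G; h \<in> carrier G\<rbrakk> \<Longrightarrow> act (g \<otimes> h) x = act g (act h x)"
    and faithful: "\<lbrakk>g \<in> carrier G; h \<in> carrier G; \<And>x. act g x = act h x\<rbrakk> \<Longrightarrow> g = h"
    and transpositions: "a \<noteq> b \<Longrightarrow> \<exists>t\<in>carrier G. act t = Transposition.transpose a b"
begin

lemma act_inv [simp]:
  assumes "g \<in> carrier G"
  shows "act (inv g) (act g x) = x" "act g (act (inv g) x) = x"
  using act_mult[of "inv g" g x] act_mult[of g "inv g" x] assms by simp_all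

lemma act_eq_iff [simp]: "g \<in> carrier G \<Longrightarrow> act g x = act g y \<longleftrightarrow> x = y"
  by (metis act_inv(1))

definition pointwise_topology :: "'a topology" where
  "pointwise_topology = topology_generated_by {{g \<in> carrier G. act g a = b} | a b. True}"

lemma openin_pointwise: "openin pointwise_topology {g \<in> carrier G. act g a = b}"
  unfolding pointwise_topology_def by (rule topology_generated_by_Basis) blast

lemma topspace_pointwise: "topspace pointwise_topology = carrier G"
  by (auto simp: pointwise_topology_def)

lemma hausdorff_group_topology_pointwise: "hausdorff_group_topology G pointwise_topology"
proof -
  let ?T = pointwise_topology
  have "Hausdorff_space ?T"
    unfolding Hausdorff_space_def topspace_pointwise
  proof (intro allI impI)
    fix g h assume gh: "g \<in> carrier G \<and> h \<in> carrier G \<and> g \<noteq> h"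
    then obtain x where "act g x \<noteq> act h x" using faithful by blast
    then show "\<exists>U V. openin ?T U \<and> openin ?T V \<and> g \<in> U \<and> h \<in> V \<and> disjnt U V"
      using gh openin_pointwise
      by (intro exI[of _ "{k \<in> carrier G. act k x = act g x}"]
          exI[of _ "{k \<in> carrier G. act k x = act h x}"]) (auto simp: disjnt_def)
  qed
  moreover have "continuous_map (prod_topology ?T ?T) ?T (\<lambda>(g, h). g \<otimes> h)"
  proof -
    have "openin (prod_topology ?T ?T)
        ((\<lambda>(g, h). g \<otimes> h) -` {g \<in> carrier G. act g a = b} \<inter> topspace (prod_topology ?T ?T))" for a b
    proof -
      have "(\<lambda>(g, h). g \<otimes> h) -` {g \<in> carrier G. act g a = b} \<inter> topspace (prod_topology ?T ?T) =
          (\<Union>y. {g \<in> carrier G. act g y = b} \<times> {h \<in> carrier G. act h a = y})"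
        by (auto simp: topspace_pointwise)
      also have "openin (prod_topology ?T ?T) \<dots>"
        by (intro openin_Union) (auto simp: openin_prod_Times_iff openin_pointwise)
      finally show ?thesis .
    qed
    then show ?thesis
      by (subst (3) pointwise_topology_def, subst continuous_on_generated_topo_iff)
        (auto simp: topspace_pointwise)
  qed
  moreover have "continuous_map ?T ?T (\<lambda>g. inv g)"
  proof -
    have "(\<lambda>g. inv g) -` {g \<in> carrier G. act g a = b} \<inter> topspace ?T =
        {g \<in> carrier G. act g b = a}" for a b
      by (auto simp: topspace_pointwise)
    then have "openin ?T ((\<lambda>g. inv g) -` {g \<in> carrier G. act g a = b} \<inter> topspace ?T)" for a b
      by (simp only: openin_pointwise)
    then show ?thesis
      by (subst (2) pointwise_topology_def, subst continuous_on_generated_topo_iff)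
        (auto simp: topspace_pointwise)
  qed
  ultimately show ?thesis
    by (simp add: hausdorff_group_topology_def topspace_pointwise)
qed

text \<open>The equation is the word \<open>x t x\<inverse> s x t\<inverse> x\<inverse> s\<inverse>\<close>.\<close>

lemma closedin_zariski_commuting_conjugate:
  assumes "t \<in> carrier G" "s \<in> carrier G"
  shows "closedin (zariski_topology G)
    {g \<in> carrier G. (g \<otimes> t \<otimes> inv g) \<otimes> s = s \<otimes> (g \<otimes> t \<otimes> inv g)}"
proof -
  let ?u = "[Inr 1, Inl t, Inr (-1), Inl s, Inr 1, Inl (inv t), Inr (-1), Inl (inv s)] :: ('a + int) list"
  have "eval_word G ?u g = \<one> \<longleftrightarrow> (g \<otimes> t \<otimes> inv g) \<otimes> s = s \<otimes> (g \<otimes> t \<otimes> inv g)"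
    if g: "g \<in> carrier G" for g
  proof -
    let ?y = "g \<otimes> t \<otimes> inv g"
    have "eval_word G ?u g = (?y \<otimes> s) \<otimes> inv (s \<otimes> ?y)"
      using g assms by (simp add: int_pow_1 int_pow_neg m_assoc inv_mult_group)
    moreover have "(?y \<otimes> s) \<otimes> inv (s \<otimes> ?y) = \<one> \<longleftrightarrow> ?y \<otimes> s = s \<otimes> ?y"
      using g assms by (metis inv_closed inv_equality inv_inv m_closed r_inv)
    ultimately show ?thesis by simp
  qed
  then have "{g \<in> carrier G. (g \<otimes> t \<otimes> inv g) \<otimes> s = s \<otimes> (g \<otimes> t \<otimes> inv g)} =
      {g \<in> carrier G. eval_word G ?u g = \<one>}" by blast
  then show ?thesis
    using closedin_zariski_eval_word[OF group_axioms, of ?u] assms by simp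
qed

lemma act_conjugate_transposition:
  assumes "g \<in> carrier G" "t \<in> carrier G" "act t = Transposition.transpose a b"
  shows "act (g \<otimes> t \<otimes> inv g) = Transposition.transpose (act g a) (act g b)"
proof
  fix x
  obtain y where "x = act g y" using act_inv(2)[OF assms(1)] by metis
  then show "act (g \<otimes> t \<otimes> inv g) x = Transposition.transpose (act g a) (act g b) x"
    using assms by (simp add: Transposition.transpose_def)
qed

text \<open>Let \<open>g0 a = b\<close>. Take three points \<open>x \<noteq> a\<close> and two points \<open>d\<close> outside \<open>b\<close> and the three \<open>g0 x\<close>,
  and demand that no conjugate \<open>g (a x) g\<inverse> = (g a g x)\<close> commutes with a \<open>(b d)\<close>. This holds for \<open>g0\<close>,
  since \<open>{b, g0 x}\<close> and \<open>{b, d}\<close> share exactly one point. Conversely, if \<open>g a \<noteq> b\<close>, choose \<open>d \<noteq> g a\<close>;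
  transpositions that do not commute have a common point, so all three points \<open>g x\<close> lie in the
  two-element set \<open>{b, d}\<close>, which is impossible.\<close>

lemma openin_zariski_act_eq: "openin (zariski_topology G) {g \<in> carrier G. act g a = b}"
proof (subst openin_subopen, intro ballI)
  fix g0 assume "g0 \<in> {g \<in> carrier G. act g a = b}"
  then have g0: "g0 \<in> carrier G" "act g0 a = b" by auto
  obtain B where B: "B \<subseteq> - {a}" "finite B" "card B = 3"
    using infinite_arbitrarily_large[of "- {a}" 3] infinite_points
    by (auto simp: Compl_eq_Diff_UNIV)
  obtain D where D: "D \<subseteq> - insert b (act g0 ` B)" "finite D" "card D = 2"
    using infinite_arbitrarily_large[of "- insert b (act g0 ` B)" 2] infinite_points B(2)
    by (auto simp: Compl_eq_Diff_UNIV)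
  have "\<exists>t\<in>carrier G. act t = Transposition.transpose a x" if "x \<in> B" for x
    using that B by (intro transpositions) auto
  then obtain t where t: "\<And>x. x \<in> B \<Longrightarrow> t x \<in> carrier G" "\<And>x. x \<in> B \<Longrightarrow> act (t x) = Transposition.transpose a x"
    by metis
  have "\<exists>s\<in>carrier G. act s = Transposition.transpose b d" if "d \<in> D" for d
    using that D by (intro transpositions) auto
  then obtain s where s: "\<And>d. d \<in> D \<Longrightarrow> s d \<in> carrier G" "\<And>d. d \<in> D \<Longrightarrow> act (s d) = Transposition.transpose b d"
    by metis
  define C where "C x d = {g \<in> carrier G.
    (g \<otimes> t x \<otimes> inv g) \<otimes> s d = s d \<otimes> (g \<otimes> t x \<otimes> inv g)}" for x d
  define V where "V = carrier G - (\<Union>x\<in>B. \<Union>d\<in>D. C x d)"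
  have "closedin (zariski_topology G) (\<Union>x\<in>B. \<Union>d\<in>D. C x d)"
    using B(2) D(2) unfolding C_def
    by (intro closedin_Union finite_imageI ballI)
      (auto intro!: closedin_Union closedin_zariski_commuting_conjugate t s)
  then have "openin (zariski_topology G) V"
    by (simp add: V_def openin_diff openin_topspace[of "zariski_topology G", simplified])
  moreover have "g0 \<in> V"
  proof -
    have "g0 \<notin> C x d" if xd: "x \<in> B" "d \<in> D" for x d
    proof
      assume "g0 \<in> C x d"
      then have "act ((g0 \<otimes> t x \<otimes> inv g0) \<otimes> s d) b = act (s d \<otimes> (g0 \<otimes> t x \<otimes> inv g0)) b"
        by (simp add: C_def)
      then have "Transposition.transpose b (act g0 x) (Transposition.transpose b d b) = Transposition.transpose b d (Transposition.transpose b (act g0 x) b)"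
        using act_conjugate_transposition[OF g0(1) t[OF xd(1)]] g0 t[OF xd(1)] s[OF xd(2)] by simp
      moreover have "d \<noteq> b" "d \<noteq> act g0 x" "act g0 x \<noteq> b"
        using xd B(1) D(1) g0 by auto
      ultimately show False by (simp add: Transposition.transpose_def)
    qed
    then show ?thesis using g0(1) by (auto simp: V_def)
  qed
  moreover have "V \<subseteq> {g \<in> carrier G. act g a = b}"
  proof
    fix g assume "g \<in> V"
    then have g: "g \<in> carrier G" "\<And>x d. \<lbrakk>x \<in> B; d \<in> D\<rbrakk> \<Longrightarrow> g \<notin> C x d"
      by (auto simp: V_def)
    have "act g a = b"
    proof (rule ccontr)
      assume ne: "act g a \<noteq> b"
      have "\<not> D \<subseteq> {act g a}"
        using D(3) card_mono[of "{act g a}" D] by auto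
      then obtain d where d: "d \<in> D" "d \<noteq> act g a" by blast
      have "act g x \<in> {b, d}" if x: "x \<in> B" for x
      proof (rule ccontr)
        assume out: "act g x \<notin> {b, d}"
        have "(g \<otimes> t x \<otimes> inv g) \<otimes> s d = s d \<otimes> (g \<otimes> t x \<otimes> inv g)"
        proof (rule faithful)
          fix y
          show "act ((g \<otimes> t x \<otimes> inv g) \<otimes> s d) y = act (s d \<otimes> (g \<otimes> t x \<otimes> inv g)) y"
            using act_conjugate_transposition[OF g(1) t[OF x]] g(1) t[OF x] s[OF d(1)] ne d out
            by (auto simp: Transposition.transpose_def)
        qed (use g(1) t[OF x] s[OF d(1)] in auto)
        then show False using g x d by (auto simp: C_def)
      qed
      then have "act g ` B \<subseteq> {b, d}" by blast
      moreover have "card (act g ` B) = 3"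
        using g(1) B(3) by (subst card_image) (auto simp: inj_on_def)
      ultimately show False
        using card_mono[of "{b, d}" "act g ` B"] by (auto simp: card_insert_if split: if_splits)
    qed
    then show "g \<in> {g \<in> carrier G. act g a = b}" using g(1) by simp
  qed
  ultimately show "\<exists>V. openin (zariski_topology G) V \<and> g0 \<in> V \<and> V \<subseteq> {g \<in> carrier G. act g a = b}"
    by blast
qed

text \<open>Markov open sets are open in the pointwise topology, whose subbasic sets are Zariski open.\<close>

theorem MZ_permutation_group: "MZ G"
proof (rule MZ_I[OF group_axioms])
  fix U assume "openin (markov_topology G) U"
  then have "closedin pointwise_topology (carrier G - U)" "U \<subseteq> carrier G"
    using hausdorff_group_topology_pointwise by (auto simp: openin_markov_topology)
  then have "openin pointwise_topology U"
    by (simp add: openin_closedin_eq topspace_pointwise)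
  then have "generate_topology_on {{g \<in> carrier G. act g a = b} | a b. True} U"
    by (simp add: pointwise_topology_def openin_topology_generated_by_iff)
  then show "openin (zariski_topology G) U"
    by induction (auto intro: openin_zariski_act_eq)
qed

end

section \<open>Every group is a quotient of such a permutation group\<close>

text \<open>Left multiplication on \<open>H \<times> \<nat>\<close> is an action of this kind for any group \<open>H\<close>. An action is a
  parameter because a smaller set of points keeps the permutation group small.\<close>

locale infinitely_moving_action = group H for H :: "('a, 'm) monoid_scheme" (structure) +
  fixes act :: "'a \<Rightarrow> 'x \<Rightarrow> 'x"
  assumes act_one: "act \<one> x = x"
    and act_mult: "\<lbrakk>g \<in> carrier H; h \<in> carrier H\<rbrakk> \<Longrightarrow> act (g \<otimes> h) x = act g (act h x)"
    and moves: "\<lbrakk>h \<in> carrier H; h \<noteq> \<one>\<rbrakk> \<Longrightarrow> infinite {x. act h x \<noteq> x}"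
    and infinite_points: "infinite (UNIV :: 'x set)"
begin

text \<open>The permutations that agree with an element of \<open>H\<close> up to finitely many points. The element is
  recorded next to the permutation, which makes the projection to \<open>H\<close> the function \<^const>\<open>fst\<close>.\<close>

definition cover :: "('a \<times> ('x \<Rightarrow> 'x)) monoid" where
  "cover = \<lparr>carrier = {(h, p). h \<in> carrier H \<and> bij p \<and> finite {x. p x \<noteq> act h x}},
    mult = (\<lambda>(h, p) (k, q). (h \<otimes> k, p \<circ> q)), one = (\<one>, id)\<rparr>"

lemma carrier_cover:
  "(h, p) \<in> carrier cover \<longleftrightarrow> h \<in> carrier H \<and> bij p \<and> finite {x. p x \<noteq> act h x}"
  by (simp add: cover_def)

lemma mult_cover: "(h, p) \<otimes>\<^bsub>cover\<^esub> (k, q) = (h \<otimes> k, p \<circ> q)"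
  by (simp add: cover_def)

lemma one_cover: "\<one>\<^bsub>cover\<^esub> = (\<one>, id)"
  by (simp add: cover_def)

lemma act_inv: "h \<in> carrier H \<Longrightarrow> act (inv h) (act h x) = x" "h \<in> carrier H \<Longrightarrow> act h (act (inv h) x) = x"
  using act_mult[of "inv h" h x] act_mult[of h "inv h" x] by (simp_all add: act_one)

lemma bij_act: "h \<in> carrier H \<Longrightarrow> bij (act h)"
  by (rule bij_betw_byWitness[of _ "act (inv h)"]) (auto simp: act_inv)

lemma group_cover: "group cover"
proof (rule groupI)
  show "\<one>\<^bsub>cover\<^esub> \<in> carrier cover"
    by (simp add: one_cover carrier_cover act_one)
next
  fix y assume "y \<in> carrier cover"
  then obtain h p where y: "y = (h, p)" "h \<in> carrier H" "bij p" "finite {x. p x \<noteq> act h x}"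
    by (cases y) (auto simp: carrier_cover)
  show "\<one>\<^bsub>cover\<^esub> \<otimes>\<^bsub>cover\<^esub> y = y" using y by (simp add: one_cover mult_cover)
  have "{x. inv_into UNIV p x \<noteq> act (inv h) x} \<subseteq> p ` {x. p x \<noteq> act h x}"
  proof
    fix x assume x: "x \<in> {x. inv_into UNIV p x \<noteq> act (inv h) x}"
    have "p (inv_into UNIV p x) = x" using y(3) by (simp add: bij_is_surj surj_f_inv_f)
    moreover have "act h (inv_into UNIV p x) \<noteq> x" using x act_inv(1)[OF y(2), of "inv_into UNIV p x"] by auto
    ultimately show "x \<in> p ` {x. p x \<noteq> act h x}"
      by (intro image_eqI[of _ _ "inv_into UNIV p x"]) auto
  qed
  then have "finite {x. inv_into UNIV p x \<noteq> act (inv h) x}"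
    using y(4) by (meson finite_imageI finite_subset)
  then have "(inv h, inv_into UNIV p) \<in> carrier cover"
    using y by (simp add: carrier_cover bij_imp_bij_inv)
  moreover have "(inv h, inv_into UNIV p) \<otimes>\<^bsub>cover\<^esub> y = \<one>\<^bsub>cover\<^esub>"
    using y by (simp add: mult_cover one_cover bij_is_inj)
  ultimately show "\<exists>z\<in>carrier cover. z \<otimes>\<^bsub>cover\<^esub> y = \<one>\<^bsub>cover\<^esub>" by blast
next
  fix y z assume "y \<in> carrier cover" "z \<in> carrier cover"
  then obtain h p k q where y: "y = (h, p)" "h \<in> carrier H" "bij p" "finite {x. p x \<noteq> act h x}"
    and z: "z = (k, q)" "k \<in> carrier H" "bij q" "finite {x. q x \<noteq> act k x}"
    by (cases y, cases z) (auto simp: carrier_cover)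
  have "{x. (p \<circ> q) x \<noteq> act (h \<otimes> k) x} \<subseteq> {x. q x \<noteq> act k x} \<union> q -` {x. p x \<noteq> act h x}"
    using y(2) z(2) by (auto simp: act_mult)
  moreover have "finite (q -` {x. p x \<noteq> act h x})"
    by (rule finite_vimageI[OF y(4) bij_is_inj[OF z(3)]])
  ultimately have "finite {x. (p \<circ> q) x \<noteq> act (h \<otimes> k) x}"
    using z(4) by (meson finite_UnI finite_subset)
  then show "y \<otimes>\<^bsub>cover\<^esub> z \<in> carrier cover"
    using y z by (simp add: mult_cover carrier_cover bij_comp)
qed (auto simp: cover_def m_assoc)

text \<open>Two elements of \<open>H\<close> within finite distance of one permutation act alike at all but finitely many
  points, hence are equal. This is where infinite movement is needed, and it makes the cover a group
  of permutations.\<close>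

lemma cover_faithful:
  assumes "(h, p) \<in> carrier cover" "(k, p) \<in> carrier cover"
  shows "h = k"
proof (rule ccontr)
  assume ne: "h \<noteq> k"
  have hk: "h \<in> carrier H" "k \<in> carrier H" using assms by (auto simp: carrier_cover)
  then have "inv k \<otimes> h \<noteq> \<one>" using ne by (metis inv_closed inv_equality inv_inv)
  then have "infinite {x. act (inv k \<otimes> h) x \<noteq> x}" using hk by (intro moves) auto
  moreover have "{x. act (inv k \<otimes> h) x \<noteq> x} \<subseteq> {x. p x \<noteq> act h x} \<union> {x. p x \<noteq> act k x}"
    using hk by (auto simp: act_mult act_inv)
  ultimately show False
    using assms by (auto simp: carrier_cover dest: finite_subset)
qed

lemma permutation_group_cover: "permutation_group cover snd"
proof (intro permutation_group.intro group_cover permutation_group_axioms.intro)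
  show "\<exists>t\<in>carrier cover. snd t = Transposition.transpose a b" for a b :: 'x
  proof -
    have "finite {x. Transposition.transpose a b x \<noteq> act \<one> x}"
      by (rule finite_subset[of _ "{a, b}"]) (auto simp: act_one Transposition.transpose_def)
    then show ?thesis
      by (intro bexI[of _ "(\<one>, Transposition.transpose a b)"]) (auto simp: carrier_cover)
  qed
  show "y = z" if "y \<in> carrier cover" "z \<in> carrier cover" "\<And>x. snd y x = snd z x" for y z
  proof -
    have "snd y = snd z" using that(3) by blast
    then show ?thesis
      using that(1,2) cover_faithful[of "fst y" "snd y" "fst z"] by (metis prod.collapse)
  qed
qed (auto simp: infinite_points one_cover mult_cover)

lemma MZ_cover: "MZ cover"
  by (rule permutation_group.MZ_permutation_group[OF permutation_group_cover])

lemma fst_cover: "fst \<in> hom cover H" "fst ` carrier cover = carrier H"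
proof -
  show "fst \<in> hom cover H" by (auto simp: hom_def cover_def)
  have "h \<in> fst ` carrier cover" if "h \<in> carrier H" for h
    using that bij_act[OF that] by (intro image_eqI[of _ _ "(h, act h)"]) (auto simp: carrier_cover)
  then show "fst ` carrier cover = carrier H" by (auto simp: cover_def)
qed

end

section \<open>Zariski neighbourhoods of the identity\<close>

lemma (in group) int_pow_involution:
  assumes "a \<in> carrier G" "a \<otimes> a = \<one>"
  shows "a [^] (k::int) = (if even k then \<one> else a)"
proof -
  have two: "a [^] (2::int) = \<one>"
    using int_pow_mult[OF assms(1), of 1 1] assms by (simp add: int_pow_1)
  have ev: "a [^] (2 * m) = \<one>" for m :: int
    using int_pow_pow[OF assms(1), of 2 m] two by (simp add: mult.commute)
  show ?thesis
  proof (cases "even k")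
    case False
    then obtain m where "k = 2 * m + 1" by (auto elim: oddE)
    then show ?thesis
      using int_pow_mult[OF assms(1), of "2 * m" 1] ev assms by (simp add: int_pow_1)
  qed (auto simp: ev)
qed

text \<open>If \<open>a x\<close> commutes with the coefficients of a word, it can be collected at the end of the word, where
  an involution remains or cancels according to the parity of its exponents.\<close>

lemma (in group) eventually_eval_word:
  assumes inv: "\<And>x. a x \<in> carrier G" "\<And>x. a x \<otimes> a x = \<one>"
    and comm: "\<And>h. h \<in> carrier G \<Longrightarrow> \<forall>\<^sub>F x in F. a x \<otimes> h = h \<otimes> a x"
    and u: "u \<in> fp_words G integer_group"
  shows "(\<forall>\<^sub>F x in F. eval_word G u (a x) = eval_word G u \<one>) \<or>
    (\<forall>\<^sub>F x in F. eval_word G u (a x) = eval_word G u \<one> \<otimes> a x)"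
  using u
proof (induction rule: fp_words_integer_induct)
  case (Inl g u)
  have e: "eval_word G u \<one> \<in> carrier G" using Inl(2) by (rule eval_word_closed[OF one_closed])
  show ?case
    using Inl(3)
  proof
    assume "\<forall>\<^sub>F x in F. eval_word G u (a x) = eval_word G u \<one>"
    then show ?thesis by (intro disjI1) (auto elim!: eventually_mono simp del: int_pow_one)
  next
    assume "\<forall>\<^sub>F x in F. eval_word G u (a x) = eval_word G u \<one> \<otimes> a x"
    then show ?thesis
      using Inl(1) e inv(1)
      by (intro disjI2) (auto elim!: eventually_mono simp: m_assoc simp del: int_pow_one)
  qed
next
  case (Inr k u)
  let ?e = "eval_word G u \<one>"
  have e: "?e \<in> carrier G" using Inr(1) by (rule eval_word_closed[OF one_closed])
  have val: "eval_word G (Inr k # u) (a x) = (if even k then \<one> else a x) \<otimes> eval_word G u (a x)"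
    "eval_word G (Inr k # u) \<one> = ?e" for x
    using int_pow_involution[OF inv] e by simp_all
  show ?case
    using Inr(2)
  proof
    assume "\<forall>\<^sub>F x in F. eval_word G u (a x) = ?e"
    with comm[OF e] have "\<forall>\<^sub>F x in F. eval_word G (Inr k # u) (a x) = (if even k then ?e else ?e \<otimes> a x)"
      by eventually_elim (use e inv(1) in \<open>simp add: val(1) del: fp_fold.simps\<close>)
    then show ?case unfolding val(2) by (cases "even k") simp_all
  next
    assume "\<forall>\<^sub>F x in F. eval_word G u (a x) = ?e \<otimes> a x"
    with comm[OF e] have "\<forall>\<^sub>F x in F. eval_word G (Inr k # u) (a x) = (if even k then ?e \<otimes> a x else ?e)"
      by eventually_elim
        (use e inv in \<open>simp add: val(1) m_assoc[symmetric] del: fp_fold.simps, simp add: m_assoc\<close>)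
    then show ?case unfolding val(2) by (cases "even k") simp_all
  qed
qed simp

text \<open>The involutions \<open>a x\<close> converge to the identity in the Zariski topology if they asymptotically
  commute with each element and avoid each element: a word \<open>w\<close> with \<open>w(1) \<noteq> 1\<close> takes the value
  \<open>w(1)\<close> or \<open>w(1) a x\<close> at \<open>a x\<close>, and the latter is the identity for the avoided value \<open>w(1)\<inverse>\<close> only.\<close>

lemma (in group) eventually_zariski_nhd_one:
  assumes inv: "\<And>x. a x \<in> carrier G" "\<And>x. a x \<otimes> a x = \<one>"
    and comm: "\<And>h. h \<in> carrier G \<Longrightarrow> \<forall>\<^sub>F x in F. a x \<otimes> h = h \<otimes> a x"
    and ne: "\<And>h. h \<in> carrier G \<Longrightarrow> \<forall>\<^sub>F x in F. a x \<noteq> h"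
    and U: "openin (zariski_topology G) U" "\<one> \<in> U"
  shows "\<forall>\<^sub>F x in F. a x \<in> U"
proof -
  have "generate_topology_on
      (insert (carrier G) {carrier G - elementary_algebraic G w |w. w \<in> carrier (words G)}) U"
    using U(1) by (simp add: zariski_topology_def openin_topology_generated_by_iff)
  then have "\<one> \<in> U \<longrightarrow> (\<forall>\<^sub>F x in F. a x \<in> U)"
  proof induction
    case (UN K)
    show ?case
    proof
      assume "\<one> \<in> \<Union>K"
      then obtain V where "V \<in> K" "\<one> \<in> V" by blast
      then have "\<forall>\<^sub>F x in F. a x \<in> V" using UN by blast
      then show "\<forall>\<^sub>F x in F. a x \<in> \<Union>K" by (rule eventually_mono) (use \<open>V \<in> K\<close> in blast)
    qed
  next
    case (Basis V)
    show ?case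
    proof
      assume one: "\<one> \<in> V"
      show "\<forall>\<^sub>F x in F. a x \<in> V"
      proof (cases "V = carrier G")
        case False
        then obtain w where w: "w \<in> carrier (words G)" "V = carrier G - elementary_algebraic G w"
          using Basis by blast
        then obtain u where u: "u \<in> fp_words G integer_group" and "w = fp_class G integer_group u"
          by (auto simp: free_product_carrier)
        then have V: "V = carrier G - {g \<in> carrier G. eval_word G u g = \<one>}"
          using w(2) by (simp only: elementary_algebraic_fp_class[OF group_axioms])
        have e: "eval_word G u \<one> \<in> carrier G" "eval_word G u \<one> \<noteq> \<one>"
          using one eval_word_closed[OF one_closed u] by (simp_all add: V del: int_pow_one)
        have "\<forall>\<^sub>F x in F. eval_word G u (a x) \<noteq> \<one>"
          using eventually_eval_word[where a = a, OF inv comm u]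
        proof
          assume "\<forall>\<^sub>F x in F. eval_word G u (a x) = eval_word G u \<one>"
          then show ?thesis by eventually_elim (use e in simp)
        next
          assume "\<forall>\<^sub>F x in F. eval_word G u (a x) = eval_word G u \<one> \<otimes> a x"
          with ne[OF inv_closed[OF e(1)]] show ?thesis
            by eventually_elim (use e inv(1) in \<open>metis inv_equality inv_inv m_closed\<close>)
        qed
        then show ?thesis by eventually_elim (use V inv(1) in auto)
      qed (use inv(1) in simp)
    qed
  qed (auto elim: eventually_elim2)
  then show ?thesis using U(2) by blast
qed

section \<open>A group whose Markov topology is strictly finer than its Zariski topology\<close>

type_synonym heis = "(nat \<times> nat) fset \<times> (nat \<times> nat) set \<times> bool"

definition fsym_diff :: "'a fset \<Rightarrow> 'a fset \<Rightarrow> 'a fset" where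
  "fsym_diff P Q = (P |-| Q) |\<union>| (Q |-| P)"

lemma fset_fsym_diff: "fset (fsym_diff P Q) = sym_diff (fset P) (fset Q)"
  by (simp add: fsym_diff_def)

lemma fsym_diff_simps [simp]:
  "fsym_diff {||} P = P" "fsym_diff P {||} = P" "fsym_diff P P = {||}"
  "fsym_diff (fsym_diff P Q) R = fsym_diff P (fsym_diff Q R)"
  "fsym_diff P Q = P \<longleftrightarrow> Q = {||}"
  by (auto simp: fset_fsym_diff simp flip: fset_inject)

lemma fsym_diff_commute: "fsym_diff P Q = fsym_diff Q P"
  by (auto simp: fset_fsym_diff simp flip: fset_inject)

text \<open>The bilinear pairing over the two-element field, with finite sets and sets as vectors and covectors
  and with symmetric difference as addition.\<close>

definition pairing :: "'a set \<Rightarrow> 'a fset \<Rightarrow> bool" where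
  "pairing E P \<longleftrightarrow> odd (card (E \<inter> fset P))"

lemma odd_card_sym_diff:
  assumes "finite A" "finite B"
  shows "odd (card (sym_diff A B)) \<longleftrightarrow> (odd (card A) \<noteq> odd (card B))"
proof -
  have "card A = card (A - B) + card (A \<inter> B)" "card B = card (B - A) + card (A \<inter> B)"
    using assms by (metis card_Int_Diff add.commute) (metis assms(2) card_Int_Diff add.commute Int_commute)
  moreover have "card (sym_diff A B) = card (A - B) + card (B - A)"
    using assms by (intro card_Un_disjoint) auto
  ultimately show ?thesis by auto
qed

lemma pairing_sym_diff: "pairing (sym_diff E F) P \<longleftrightarrow> (pairing E P \<noteq> pairing F P)"
proof -
  have "sym_diff E F \<inter> fset P = sym_diff (E \<inter> fset P) (F \<inter> fset P)" by blast
  then show ?thesis unfolding pairing_def by (simp only: odd_card_sym_diff[OF finite_Int finite_Int] finite_fset disjI2 disjI1)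
qed

lemma pairing_fsym_diff: "pairing E (fsym_diff P Q) \<longleftrightarrow> (pairing E P \<noteq> pairing E Q)"
proof -
  have "E \<inter> sym_diff (fset P) (fset Q) = sym_diff (E \<inter> fset P) (E \<inter> fset Q)" by blast
  then show ?thesis unfolding pairing_def fset_fsym_diff
    by (simp only: odd_card_sym_diff[OF finite_Int finite_Int] finite_fset disjI2 disjI1)
qed

lemma pairing_empty [simp]: "\<not> pairing {} P" "\<not> pairing E {||}"
  by (simp_all add: pairing_def)

lemma pairing_singleton [simp]: "pairing E {|x|} \<longleftrightarrow> x \<in> E"
  by (cases "x \<in> E") (simp_all add: pairing_def)

lemma pairing_disjoint: "E \<inter> fset P = {} \<Longrightarrow> \<not> pairing E P"
  by (simp add: pairing_def)

definition column_finite :: "(nat \<times> nat) set \<Rightarrow> bool" where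
  "column_finite E \<longleftrightarrow> (\<forall>n. finite {i. (n, i) \<in> E})"

lemma column_finite_sym_diff:
  "column_finite E \<Longrightarrow> column_finite F \<Longrightarrow> column_finite (sym_diff E F)"
  unfolding column_finite_def
  by (auto intro: finite_subset[where B = "{i. (n, i) \<in> E} \<union> {i. (n, i) \<in> F}" for n])

lemma column_finite_empty [simp]: "column_finite {}"
  by (simp add: column_finite_def)

text \<open>Triples of a vector, a covector and a scalar, multiplied with the cocycle \<^const>\<open>pairing\<close>.\<close>

definition heisenberg :: "heis monoid" where
  "heisenberg = \<lparr>carrier = {(P, E, s). column_finite E},
    mult = (\<lambda>(P, E, s) (Q, F, t). (fsym_diff P Q, sym_diff E F, s \<noteq> (t \<noteq> pairing E Q))),
    one = ({||}, {}, False)\<rparr>"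

lemma heisenberg_simps [simp]:
  "(P, E, s) \<in> carrier heisenberg \<longleftrightarrow> column_finite E"
  "(P, E, s) \<otimes>\<^bsub>heisenberg\<^esub> (Q, F, t) = (fsym_diff P Q, sym_diff E F, s \<noteq> (t \<noteq> pairing E Q))"
  "\<one>\<^bsub>heisenberg\<^esub> = ({||}, {}, False)"
  by (simp_all add: heisenberg_def)

lemma group_heisenberg: "group heisenberg"
proof (rule groupI)
  fix x y z assume "x \<in> carrier heisenberg" "y \<in> carrier heisenberg" "z \<in> carrier heisenberg"
  then show "x \<otimes>\<^bsub>heisenberg\<^esub> y \<otimes>\<^bsub>heisenberg\<^esub> z = x \<otimes>\<^bsub>heisenberg\<^esub> (y \<otimes>\<^bsub>heisenberg\<^esub> z)"
    by (cases x, cases y, cases z) (auto simp: pairing_sym_diff pairing_fsym_diff)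
next
  fix x assume "x \<in> carrier heisenberg"
  then obtain P E s where x: "x = (P, E, s)" "column_finite E" by (cases x) auto
  show "\<exists>y\<in>carrier heisenberg. y \<otimes>\<^bsub>heisenberg\<^esub> x = \<one>\<^bsub>heisenberg\<^esub>"
    using x by (intro bexI[of _ "(P, E, s \<noteq> pairing E P)"]) auto
qed (auto simp: column_finite_sym_diff)

text \<open>The covector part is an initial segment of the column. Of two points in a column, exactly one lies in
  the segment below the other, so exactly one of the two pairings that decide commutation is odd.\<close>

definition generator :: "nat \<times> nat \<Rightarrow> heis" where
  "generator x = ({|x|}, {fst x} \<times> {..<snd x}, False)"

definition central :: heis where
  "central = ({||}, {}, True)"

definition dual :: "(nat \<times> nat) set \<Rightarrow> heis" where
  "dual D = ({||}, D, False)"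

lemma column_finite_segment [simp]: "column_finite ({n} \<times> {..<i})"
  by (auto simp: column_finite_def intro: finite_subset[of _ "{..<i}"])

lemma named_elements_in_carrier [simp]:
  "generator x \<in> carrier heisenberg" "central \<in> carrier heisenberg"
  "column_finite D \<Longrightarrow> dual D \<in> carrier heisenberg"
  by (auto simp: generator_def central_def dual_def)

lemma generator_inj: "generator x = generator y \<longleftrightarrow> x = y"
  by (auto simp: generator_def)

text \<open>The commutator of two elements is the difference of the two mixed pairings; it is \<^const>\<open>central\<close> if
  they differ and trivial otherwise.\<close>

lemma heisenberg_commute_iff:
  "(P, E, s) \<otimes>\<^bsub>heisenberg\<^esub> (Q, F, t) = (Q, F, t) \<otimes>\<^bsub>heisenberg\<^esub> (P, E, s) \<longleftrightarrow>
    (pairing E Q \<longleftrightarrow> pairing F P)"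
  by (auto simp: fsym_diff_commute)

lemma heisenberg_anticommute_iff:
  "(P, E, s) \<otimes>\<^bsub>heisenberg\<^esub> (Q, F, t) =
     central \<otimes>\<^bsub>heisenberg\<^esub> ((Q, F, t) \<otimes>\<^bsub>heisenberg\<^esub> (P, E, s)) \<longleftrightarrow>
    \<not> (pairing E Q \<longleftrightarrow> pairing F P)"
  by (auto simp: fsym_diff_commute central_def)

lemma finite_subsingleton: "(\<And>i j. i \<in> S \<Longrightarrow> j \<in> S \<Longrightarrow> i = j) \<Longrightarrow> finite S"
  by (metis finite.emptyI finite.insertI finite_subset insertCI subsetI)

text \<open>The topology enters through joint continuity at \<open>(p, p)\<close>, which yields a neighbourhood of \<open>p\<close>
  without anticommuting pairs. The indices of the generators in it have at most one point in each column, so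
  that the group contains an element dual to them. That element is chosen adapted to both the topology
  and \<open>p\<close>, which a fixed finite family of equations cannot achieve.\<close>

lemma closedin_generators:
  assumes "hausdorff_group_topology heisenberg T"
  shows "closedin T (range generator)"
proof -
  let ?H = heisenberg
  have T: "topspace T = carrier ?H" "Hausdorff_space T"
    using assms by (auto simp: hausdorff_group_topology_def)
  have const: "continuous_map X T (\<lambda>_. c)" if "c \<in> carrier ?H" for X :: "'z topology" and c
    using that T by simp
  have ident: "continuous_map T T (\<lambda>u. u)" using continuous_map_id[of T] by (simp add: id_def)
  have "openin T (carrier ?H - range generator)"
  proof (subst openin_subopen, intro ballI)
    fix p assume "p \<in> carrier ?H - range generator"
    then have p: "p \<in> carrier ?H" "p \<notin> range generator" by auto
    obtain P E s where pdef: "p = (P, E, s)" by (cases p)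
    have "closedin (prod_topology T T) {x \<in> topspace (prod_topology T T).
        fst x \<otimes>\<^bsub>?H\<^esub> snd x = central \<otimes>\<^bsub>?H\<^esub> (snd x \<otimes>\<^bsub>?H\<^esub> fst x)}"
      by (intro closedin_continuous_maps_eq[OF T(2)] continuous_map_group_mult[OF assms]
          continuous_map_fst continuous_map_snd const) simp
    then have "openin (prod_topology T T) (topspace (prod_topology T T) - {x \<in> topspace (prod_topology T T).
        fst x \<otimes>\<^bsub>?H\<^esub> snd x = central \<otimes>\<^bsub>?H\<^esub> (snd x \<otimes>\<^bsub>?H\<^esub> fst x)})" (is "openin _ ?O") by blast
    moreover have "(p, p) \<in> ?O"
      using p(1) T(1) by (simp add: pdef heisenberg_anticommute_iff del: heisenberg_simps)
    ultimately obtain V W where VW: "openin T V" "openin T W" "p \<in> V" "p \<in> W" "V \<times> W \<subseteq> ?O"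
      unfolding openin_prod_topology_alt by meson
    define U where "U = V \<inter> W"
    have U: "openin T U" "p \<in> U" using VW by (auto simp: U_def)
    have indep: "u \<otimes>\<^bsub>?H\<^esub> v \<noteq> central \<otimes>\<^bsub>?H\<^esub> (v \<otimes>\<^bsub>?H\<^esub> u)" if "u \<in> U" "v \<in> U" for u v
      using VW(5) that by (auto simp: U_def)
    define D where "D = {x. generator x \<in> U}"
    have inj: "i = j" if "(n, i) \<in> D" "(n, j) \<in> D" for n i j
      using indep[of "generator (n, i)" "generator (n, j)"] that
      by (cases i j rule: linorder_cases)
        (simp_all add: D_def generator_def heisenberg_anticommute_iff del: heisenberg_simps)
    \<comment> \<open>Dropping the finitely many points of \<open>P\<close> makes \<open>dual D'\<close> commute with \<open>p\<close>; the generators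
      dropped are removed one by one afterwards.\<close>
    define D' where "D' = D - fset P"
    have "finite {i. (n, i) \<in> D'}" for n
      using inj by (intro finite_subsingleton) (auto simp: D'_def)
    then have D': "column_finite D'" by (simp add: column_finite_def)
    have "closedin T {u \<in> topspace T. u \<otimes>\<^bsub>?H\<^esub> dual D' = central \<otimes>\<^bsub>?H\<^esub> (dual D' \<otimes>\<^bsub>?H\<^esub> u)}"
      (is "closedin T ?C")
      by (intro closedin_continuous_maps_eq[OF T(2)] continuous_map_group_mult[OF assms] const ident
          named_elements_in_carrier D')
    moreover have "closedin T (generator ` (D \<inter> fset P))"
      by (rule closedin_Hausdorff_finite[OF T(2)]) (simp_all add: T(1) image_subset_iff)
    ultimately have "openin T (U - ?C - generator ` (D \<inter> fset P))" (is "openin T ?V")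
      using U(1) by (intro openin_diff)
    moreover have "p \<notin> ?C"
      using pairing_disjoint[of D' P]
      by (auto simp: pdef dual_def D'_def heisenberg_anticommute_iff simp del: heisenberg_simps)
    moreover have "generator x \<notin> ?V" for x
    proof (cases "x \<in> D'")
      case True
      then have "generator x \<otimes>\<^bsub>?H\<^esub> dual D' = central \<otimes>\<^bsub>?H\<^esub> (dual D' \<otimes>\<^bsub>?H\<^esub> generator x)"
        by (simp add: generator_def dual_def heisenberg_anticommute_iff del: heisenberg_simps)
      then show ?thesis by (simp add: T(1))
    next
      case False
      then show ?thesis by (auto simp: D_def D'_def)
    qed
    ultimately have V: "openin T ?V" "p \<notin> ?C" "\<And>x. generator x \<notin> ?V" by blast+
    have "p \<in> ?V" using U(2) V(2) p(2) by blast
    moreover have "?V \<subseteq> carrier ?H - range generator"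
      using openin_subset[OF V(1)] V(3) T(1) by blast
    ultimately show "\<exists>V. openin T V \<and> p \<in> V \<and> V \<subseteq> carrier ?H - range generator"
      using V(1) by blast
  qed
  then show ?thesis unfolding closedin_def T(1) by (simp add: image_subset_iff)
qed

text \<open>The limit over rows inside the limit over columns: its large sets contain almost all of almost every
  column. A set with finite columns is negligible here even if the sizes of its columns are unbounded, which
  the product filter would not provide.\<close>

definition iterated :: "(nat \<times> nat) filter" where
  "iterated = Abs_filter (\<lambda>P. \<forall>\<^sub>F n in sequentially. \<forall>\<^sub>F i in sequentially. P (n, i))"

lemma eventually_iterated:
  "eventually P iterated \<longleftrightarrow> (\<forall>\<^sub>F n in sequentially. \<forall>\<^sub>F i in sequentially. P (n, i))"
  unfolding iterated_def
proof (rule eventually_Abs_filter, unfold_locales)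
  fix P Q :: "nat \<times> nat \<Rightarrow> bool"
  assume "\<forall>\<^sub>F n in sequentially. \<forall>\<^sub>F i in sequentially. P (n, i)"
    "\<forall>\<^sub>F n in sequentially. \<forall>\<^sub>F i in sequentially. Q (n, i)"
  then show "\<forall>\<^sub>F n in sequentially. \<forall>\<^sub>F i in sequentially. P (n, i) \<and> Q (n, i)"
    by (rule eventually_elim2) (rule eventually_conj)
next
  fix P Q :: "nat \<times> nat \<Rightarrow> bool"
  assume "\<forall>x. P x \<longrightarrow> Q x" "\<forall>\<^sub>F n in sequentially. \<forall>\<^sub>F i in sequentially. P (n, i)"
  then show "\<forall>\<^sub>F n in sequentially. \<forall>\<^sub>F i in sequentially. Q (n, i)"
    by (auto elim!: eventually_mono)
qed simp

text \<open>Only columns that meet the finite set \<open>P\<close> can have segments that pair nontrivially with \<open>P\<close>, and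
  in each other column only the finitely many points of \<open>E\<close> give generators that anticommute with \<open>h\<close>.\<close>

lemma eventually_generator_commutes:
  assumes "h \<in> carrier heisenberg"
  shows "\<forall>\<^sub>F x in iterated. generator x \<otimes>\<^bsub>heisenberg\<^esub> h = h \<otimes>\<^bsub>heisenberg\<^esub> generator x"
proof -
  obtain P E s where h: "h = (P, E, s)" "column_finite E" using assms by (cases h) auto
  have column: "\<forall>\<^sub>F i in sequentially. (n, i) \<notin> E" for n
    using h(2) by (simp add: column_finite_def eventually_cofinite flip: cofinite_eq_sequentially)
  have "\<forall>\<^sub>F n in sequentially. n \<notin> fst ` fset P"
    using finite_imageI[OF finite_fset[of P], of fst]
    by (simp add: eventually_cofinite flip: cofinite_eq_sequentially)
  then show ?thesis
    unfolding eventually_iterated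
  proof eventually_elim
    case (elim n)
    have "\<not> pairing ({n} \<times> {..<i}) P" for i
      using elim by (intro pairing_disjoint) force
    then show ?case
      using column[of n]
      by (auto elim!: eventually_mono
          simp: h generator_def heisenberg_commute_iff simp del: heisenberg_simps)
  qed
qed

lemma eventually_generator_neq: "\<forall>\<^sub>F x in iterated. generator x \<noteq> h"
proof -
  have "finite {i. generator (n, i) = h}" for n
    by (intro finite_subsingleton) (auto simp: generator_inj)
  then show ?thesis
    unfolding eventually_iterated
    by (simp add: eventually_cofinite flip: cofinite_eq_sequentially)
qed

lemma not_zariski_closedin_generators: "\<not> closedin (zariski_topology heisenberg) (range generator)"
proof
  interpret group heisenberg by (rule group_heisenberg)
  assume "closedin (zariski_topology heisenberg) (range generator)"
  then have "openin (zariski_topology heisenberg) (carrier heisenberg - range generator)"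
    by (simp add: closedin_def)
  moreover have "\<one>\<^bsub>heisenberg\<^esub> \<in> carrier heisenberg - range generator"
    by (auto simp: generator_def)
  moreover have "generator x \<otimes>\<^bsub>heisenberg\<^esub> generator x = \<one>\<^bsub>heisenberg\<^esub>" for x
    by (cases x) (simp add: generator_def)
  ultimately have "\<forall>\<^sub>F x in iterated. generator x \<in> carrier heisenberg - range generator"
    using eventually_zariski_nhd_one[of generator iterated, OF named_elements_in_carrier(1)]
      eventually_generator_commutes eventually_generator_neq by blast
  then show False by (simp add: eventually_iterated)
qed

lemma not_MZ_heisenberg: "\<not> MZ heisenberg"
proof
  assume "MZ heisenberg"
  then have "closedin (zariski_topology heisenberg) (range generator) \<longleftrightarrow>
      closedin (markov_topology heisenberg) (range generator)" by (simp add: MZ_def)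
  moreover have "closedin (markov_topology heisenberg) (range generator)"
    using closedin_generators by (auto simp: closedin_markov_topology)
  ultimately show False using not_zariski_closedin_generators by blast
qed

text \<open>The Schroedinger representation: vectors translate the finite sets, while covectors and scalars act
  on the sign.\<close>

definition heis_act :: "heis \<Rightarrow> (nat \<times> nat) fset \<times> bool \<Rightarrow> (nat \<times> nat) fset \<times> bool" where
  "heis_act = (\<lambda>(P, E, s) (Q, t). (fsym_diff P Q, t \<noteq> (s \<noteq> pairing E Q)))"

lemma infinite_heis_points: "infinite (UNIV :: ((nat \<times> nat) fset \<times> bool) set)"
proof
  assume "finite (UNIV :: ((nat \<times> nat) fset \<times> bool) set)"
  then have "finite (range (\<lambda>i::nat. ({|(0::nat, i)|}, True)))" by (rule rev_finite_subset) simp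
  moreover have "inj (\<lambda>i::nat. ({|(0::nat, i)|}, True))" by (simp add: inj_on_def)
  ultimately show False using finite_imageD by blast
qed

text \<open>Translations and the central element move all points. A nonzero covector changes the sign at one of
  \<open>Q\<close> and \<open>fsym_diff Q {|x|}\<close>, for any \<open>x\<close> in it, so the points moved and their images under this flip
  exhaust the infinite set.\<close>

lemma heis_act_moves:
  assumes "h \<noteq> \<one>\<^bsub>heisenberg\<^esub>"
  shows "infinite {x. heis_act h x \<noteq> x}"
proof -
  obtain P E s where h: "h = (P, E, s)" by (cases h)
  show ?thesis
  proof (cases "P = {||}")
    case False
    then have "{x. heis_act h x \<noteq> x} = UNIV"
      by (auto simp: h heis_act_def fsym_diff_commute[of P])
    then show ?thesis using infinite_heis_points by simp
  next
    case P: True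
    have moved: "heis_act h (Q, t) \<noteq> (Q, t) \<longleftrightarrow> s \<noteq> pairing E Q" for Q t
      by (auto simp: h heis_act_def P)
    show ?thesis
    proof (cases "E = {}")
      case True
      then have "{x. heis_act h x \<noteq> x} = UNIV"
        using assms moved by (auto simp: h P)
      then show ?thesis using infinite_heis_points by simp
    next
      case False
      then obtain x where x: "x \<in> E" by blast
      let ?M = "{x. heis_act h x \<noteq> x}"
      let ?flip = "\<lambda>(Q, t :: bool). (fsym_diff Q {|x|}, t)"
      have "UNIV \<subseteq> ?M \<union> ?flip ` ?M"
      proof
        fix y :: "(nat \<times> nat) fset \<times> bool"
        obtain Q t where y: "y = (Q, t)" by (cases y)
        show "y \<in> ?M \<union> ?flip ` ?M"
        proof (cases "s = pairing E Q")
          case True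
          then have "(fsym_diff Q {|x|}, t) \<in> ?M" using x by (simp add: moved pairing_fsym_diff)
          then have "?flip (fsym_diff Q {|x|}, t) \<in> ?flip ` ?M" by (rule imageI)
          then show ?thesis by (simp add: y)
        qed (simp add: y moved)
      qed
      then show ?thesis using infinite_heis_points finite_subset by blast
    qed
  qed
qed

interpretation heis: infinitely_moving_action heisenberg heis_act
proof (intro infinitely_moving_action.intro group_heisenberg infinitely_moving_action_axioms.intro)
  fix g h x
  show "heis_act (g \<otimes>\<^bsub>heisenberg\<^esub> h) x = heis_act g (heis_act h x)"
    by (cases g, cases h, cases x) (auto simp: heis_act_def pairing_sym_diff pairing_fsym_diff)
  show "heis_act \<one>\<^bsub>heisenberg\<^esub> x = x"
    by (cases x) (simp add: heis_act_def)
  show "infinite {x. heis_act h x \<noteq> x}" if "h \<noteq> \<one>\<^bsub>heisenberg\<^esub>"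
    by (rule heis_act_moves[OF that])
qed (rule infinite_heis_points)

section \<open>The example\<close>

lemma (in group) image_group_iso:
  assumes "inj_on f (carrier G)"
  shows "f \<in> iso G (image_group f G)" "group (image_group f G)"
proof -
  show iso: "f \<in> iso G (image_group f G)"
    using assms by (auto simp: iso_def hom_def image_group_def bij_betw_def)
  show "group (image_group f G)"
    using iso_imp_img_group[OF iso] by (simp add: image_group_def)
qed

text \<open>The cover of the Heisenberg group is copied to sets of reals, and the kernel of its projection gives
  the normal subgroup.\<close>
theorem corollary2p2:
  shows "\<exists>(G :: real set monoid) N. MZ G \<and> N \<lhd> G \<and> \<not> MZ (G Mod N)"
proof -
  interpret K: group heis.cover by (rule heis.group_cover)
  \<comment> \<open>The points form a countable type, so the graph of a permutation is coded by a set of natural numbers.\<close>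
  define code :: "heis \<times> ((nat \<times> nat) fset \<times> bool \<Rightarrow> (nat \<times> nat) fset \<times> bool) \<Rightarrow> real set"
    where "code = (\<lambda>(h, p). range (\<lambda>x. real (to_nat (x, p x))))"
  have "inj_on code (carrier heis.cover)"
  proof (rule inj_onI)
    fix y z assume yz: "y \<in> carrier heis.cover" "z \<in> carrier heis.cover" and eq: "code y = code z"
    obtain h p k q where y: "y = (h, p)" and z: "z = (k, q)" by (cases y, cases z)
    have "p x = q x" for x
    proof -
      have "real (to_nat (x, p x)) \<in> code z"
        unfolding eq[symmetric] by (simp add: code_def y)
      then show ?thesis by (auto simp: code_def z)
    qed
    then have "p = q" by blast
    then show "y = z" using yz heis.cover_faithful by (auto simp: y z)
  qed
  define G where "G = image_group code heis.cover"
  have code: "code \<in> iso heis.cover G" and "group G"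
    using K.image_group_iso[OF \<open>inj_on code _\<close>] by (simp_all add: G_def)
  interpret G: group G by fact
  have "MZ G"
    using MZ_iso[OF heis.MZ_cover G.group_axioms] code by (auto simp: is_iso_def)
  define k where "k = inv_into (carrier heis.cover) code"
  have k: "k \<in> iso G heis.cover"
    unfolding k_def by (rule K.iso_set_sym[OF code])
  interpret f: group_hom G heisenberg "fst \<circ> k"
  proof (intro group_hom.intro group_hom_axioms.intro G.group_axioms group_heisenberg)
    show "fst \<circ> k \<in> hom G heisenberg"
      using k heis.fst_cover(1) by (auto simp: iso_def intro: hom_compose)
  qed
  define N where "N = kernel G heisenberg (fst \<circ> k)"
  have "N \<lhd> G" unfolding N_def by (rule f.normal_kernel)
  have "(fst \<circ> k) ` carrier G = carrier heisenberg"
    unfolding image_comp[symmetric] using k heis.fst_cover(2) by (simp add: iso_def bij_betw_def)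
  then have "G Mod N \<cong> heisenberg"
    unfolding N_def by (rule f.FactGroup_iso)
  then have "\<not> MZ (G Mod N)"
    using MZ_iso[OF _ group_heisenberg] not_MZ_heisenberg by blast
  then show ?thesis using \<open>MZ G\<close> \<open>N \<lhd> G\<close> by blast
qed

end
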